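(* Let $\mathbf{\Phi}_\delta$ be the matrix-valued scaled kernel with a positive scaling factor $\delta$ built from the Wendland functions $\psi_{\tau+1},\psi_{\tau-1}$ (definitions in the context). Let $X=\{\mathbf{x}_1,\dots,\mathbf{x}_M\}$ consist of pairwise distinct interior centres $\mathbf{x}_1,\dots,\mathbf{x}_N\in\Omega$ and boundary centres $\mathbf{x}_{N+1},\dots,\mathbf{x}_M\in\partial\Omega$, with mesh norms $h_1$ (interior) and $h_2$ (boundary), and $\bar h=\max(h_1,h_2)$. Assume that $M\le C_0\bar h^{-d}$ for a constant $C_0$. Then the largest eigenvalue of the symmetric collocation matrix $\mathbf{A}_\delta$ for the Stokes problem can be bounded by $$\lambda_{\max}(\mathbf{A}_\delta)\le C\,\delta^{-d-2}\,\bar h^{-d}\quad\text{if }\delta\ge1,$$ and by $$\lambda_{\max}(\mathbf{A}_\delta)\le C\,\delta^{-d-6}\,\bar h^{-d}\quad\text{if }\delta<1,$$ where the constants $C$ are independent of the point set $X$ (they may depend on $C_0$).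
   Context: $\Omega\subset\mathbb{R}^d$ ($d\ge2$) is a bounded domain with smooth boundary, $\nu>0$ is the viscosity. **Mesh norms.** For interior points $X_1\subset\Omega$: $h_1=\sup_{\mathbf{x}\in\Omega}\min_{\mathbf{x}_j\in X_1}\|\mathbf{x}-\mathbf{x}_j\|_2$. For boundary points $X_2\subset\partial\Omega$: fix a finite cover of $\partial\Omega$ by patches $V_j$ parametrized by smooth charts $\varphi_j:B\to V_j$ ($B$ the unit ball of $\mathbb{R}^{d-1}$), and let $h_2=\max_jh_{T_j,B}$, $T_j=\varphi_j^{-1}(X_2\cap V_j)$, where $h_{T,B}$ is the mesh norm of $T$ in $B$. **Wendland functions.** For $k\in\mathbb{N}$ and $\ell=\lfloor d/2\rfloor+k+1$, $\psi_{\ell,k}(r)=\frac{1}{\Gamma(k)2^{k-1}}\int_r^1s(1-s)^\ell(s^2-r^2)^{k-1}\mathrm{d}s$ for $0\le r\le1$ and $\psi_{\ell,k}(r)=0$ for $r>1$. The function $\mathbf{x}\mapsto\psi_{\ell,k}(\|\mathbf{x}\|_2)$ on $\mathbb{R}^d$ is positive definite and its Fourier transform lies between two positive multiples of $(1+\|\boldsymbol\omega\|_2^2)^{-\frac{d+1}{2}-k}$. **Kernels.** $\psi_{\tau-1}$ and $\psi_{\tau+1}$ denote the Wendland functions with smoothness parameters $k$ and $k+2$ respectively (each with its corresponding $\ell$), where $k\ge2$ and $\tau=\frac{d+3}{2}+k$, so that $\widehat{\psi_{\tau\pm1}}$ is comparable with $(1+\|\boldsymbol\omega\|_2^2)^{-\tau\mp1}$.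 They are regarded as radial functions on $\mathbb{R}^d$. For $\delta>0$, $\psi_{\tau\pm1,\delta}(\mathbf{x})=\delta^{-d}\psi_{\tau\pm1}(\|\mathbf{x}\|_2/\delta)$, $\mathbf{\Psi}_{\tau+1,\delta}=(-\Delta\mathbf{I}+\nabla\nabla^T)\psi_{\tau+1,\delta}$, $\mathbf{\Phi}_\delta=\begin{pmatrix}\mathbf{\Psi}_{\tau+1,\delta}&0\\0&\psi_{\tau-1,\delta}\end{pmatrix}:\mathbb{R}^d\to\mathbb{R}^{(d+1)\times(d+1)}$. **Collocation matrix.** For $\mathbf{v}=(v_1,\dots,v_{d+1})$ put $(L\mathbf{v})_i=-\nu\sum_{j=1}^d\partial_{jj}v_i+\partial_iv_{d+1}$, $1\le i\le d$. Define functionals, for $1\le i\le d$: $\xi_{i,j}(\mathbf{v})=(L\mathbf{v})_i(\mathbf{x}_j)$ for $1\le j\le N$ and $\xi_{i,j}(\mathbf{v})=v_i(\mathbf{x}_j)$ for $N+1\le j\le M$. Then $\mathbf{A}_\delta$ is the symmetric positive definite $dM\times dM$ matrix with entries $\xi_{i,j}\,\xi_{i',k}^{\mathbf{y}}\mathbf{\Phi}_\delta(\mathbf{x}-\mathbf{y})$, where $\xi_{i',k}^{\mathbf{y}}$ acts on each row of $\mathbf{\Phi}_\delta(\mathbf{x}-\mathbf{y})$ as a function of $\mathbf{y}$, producing an $\mathbb{R}^{d+1}$-valued function of $\mathbf{x}$, to which $\xi_{i,j}$ is then applied. *)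

theory Defs
  imports "HOL-Analysis.Analysis" "Jordan_Normal_Form.Spectral_Radius"
begin

(* Both Matrix and Finite_Cartesian_Product use $; here it always means vec_nth. *)
no_notation vec_index (infixl "$" 100)

(* C^k on an open set; the Frechet derivative is differentiated again direction by direction. *)
fun Ck_on :: "nat \<Rightarrow> ('a::euclidean_space \<Rightarrow> 'b::euclidean_space) \<Rightarrow> 'a set \<Rightarrow> bool" where
  "Ck_on 0 f S \<longleftrightarrow> continuous_on S f"
| "Ck_on (Suc k) f S \<longleftrightarrow>
     (\<forall>x\<in>S. f differentiable (at x)) \<and>
     (\<forall>v. Ck_on k (\<lambda>x. frechet_derivative f (at x) v) S)"

definition smooth_on :: "('a::euclidean_space \<Rightarrow> 'b::euclidean_space) \<Rightarrow> 'a set \<Rightarrow> bool" where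
  "smooth_on f S \<longleftrightarrow> (\<forall>k. Ck_on k f S)"

(* Local defining functions: near each boundary point the domain is the sublevel set
   {rho < 0} of a smooth rho with nowhere vanishing derivative, so that it lies on
   one side of its boundary {rho = 0}. *)
definition smooth_boundary :: "'a::euclidean_space set \<Rightarrow> bool" where
  "smooth_boundary \<Omega> \<longleftrightarrow>
     (\<forall>p\<in>frontier \<Omega>. \<exists>U (\<rho>::'a \<Rightarrow> real).
        open U \<and> p \<in> U \<and> smooth_on \<rho> U \<and>
        (\<forall>x\<in>U. \<exists>v. frechet_derivative \<rho> (at x) v \<noteq> 0) \<and>
        \<Omega> \<inter> U = {x \<in> U. \<rho> x < 0})"

definition bounded_smooth_domain :: "'a::euclidean_space set \<Rightarrow> bool" where
  "bounded_smooth_domain \<Omega> \<longleftrightarrow>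
     open \<Omega> \<and> connected \<Omega> \<and> \<Omega> \<noteq> {} \<and> bounded \<Omega> \<and> smooth_boundary \<Omega>"

definition smooth_chart ::
    "'a::euclidean_space set \<Rightarrow> ('b::euclidean_space \<Rightarrow> 'a) \<Rightarrow> bool" where
  "smooth_chart \<Gamma> \<phi> \<longleftrightarrow>
     smooth_on \<phi> (ball 0 1) \<and>
     (\<forall>t\<in>ball 0 1. inj (frechet_derivative \<phi> (at t))) \<and>
     (\<exists>g. homeomorphism (ball 0 1) (\<phi> ` ball 0 1) \<phi> g) \<and>
     openin (top_of_set \<Gamma>) (\<phi> ` ball 0 1)"

(* The patches are V_j = phi_j(B) for j < J. *)
definition boundary_atlas ::
    "'a::euclidean_space set \<Rightarrow> nat \<Rightarrow> (nat \<Rightarrow> 'b::euclidean_space \<Rightarrow> 'a) \<Rightarrow> bool" where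
  "boundary_atlas \<Omega> J \<phi> \<longleftrightarrow>
     (\<forall>j<J. smooth_chart (frontier \<Omega>) (\<phi> j)) \<and>
     (\<Union>j<J. \<phi> j ` ball 0 1) = frontier \<Omega>"

(* Meaningful for finite nonempty T and bounded nonempty S. *)
definition mesh_norm :: "'a::metric_space set \<Rightarrow> 'a set \<Rightarrow> real" where
  "mesh_norm T S = (SUP x\<in>S. Min ((\<lambda>t. dist x t) ` T))"

(* T_j = phi_j^{-1}(X \<inter> V_j), as a subset of B *)
definition chart_preimage ::
    "('b::euclidean_space \<Rightarrow> 'a) \<Rightarrow> 'a set \<Rightarrow> 'b set" where
  "chart_preimage \<phi> X = {t \<in> ball 0 1. \<phi> t \<in> X}"

definition boundary_mesh_norm ::
    "nat \<Rightarrow> (nat \<Rightarrow> 'b::euclidean_space \<Rightarrow> 'a) \<Rightarrow> 'a set \<Rightarrow> real" where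
  "boundary_mesh_norm J \<phi> X =
     Max ((\<lambda>j. mesh_norm (chart_preimage (\<phi> j) X) (ball 0 1)) ` {..<J})"

(* psi_{l,k}(r) for k >= 1 and r >= 0 *)
definition wendland :: "nat \<Rightarrow> nat \<Rightarrow> real \<Rightarrow> real" where
  "wendland l k r =
     (if r \<le> 1
      then 1 / (Gamma (real k) * 2 ^ (k - 1)) *
           integral {r..1} (\<lambda>s. s * (1 - s) ^ l * (s\<^sup>2 - r\<^sup>2) ^ (k - 1))
      else 0)"

(* The radial function on R^d with smoothness parameter k and l = floor(d/2) + k + 1,
   scaled by delta; with tau = (d+3)/2 + k, psi_{tau-1,delta} and psi_{tau+1,delta}
   are its instances with parameters k and k + 2. *)
definition scaled_wendland :: "nat \<Rightarrow> real \<Rightarrow> real^'n \<Rightarrow> real" where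
  "scaled_wendland k \<delta> x =
     \<delta> powi (- int CARD('n)) * wendland (CARD('n) div 2 + k + 1) k (norm x / \<delta>)"

definition partial_deriv :: "'n::finite \<Rightarrow> (real^'n \<Rightarrow> real) \<Rightarrow> real^'n \<Rightarrow> real" where
  "partial_deriv i f x = deriv (\<lambda>t. f (x + t *\<^sub>R axis i 1)) 0"

definition laplacian :: "(real^'n \<Rightarrow> real) \<Rightarrow> real^'n \<Rightarrow> real" where
  "laplacian f x = (\<Sum>j\<in>UNIV. partial_deriv j (partial_deriv j f) x)"

definition divfree_kernel :: "(real^'n \<Rightarrow> real) \<Rightarrow> real^'n \<Rightarrow> real^'n^'n" where
  "divfree_kernel f x =
     (\<chi> i j. - (if i = j then laplacian f x else 0) + partial_deriv i (partial_deriv j f) x)"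

(* R^{d+1} is real^('n option): Some i is the i-th velocity component and None
   the pressure component d+1. *)
definition stokes_kernel :: "nat \<Rightarrow> real \<Rightarrow> real^'n \<Rightarrow> real^('n option)^('n option)" where
  "stokes_kernel k \<delta> x =
     (\<chi> r s. case (r, s) of
         (Some i, Some j) \<Rightarrow> divfree_kernel (scaled_wendland (k + 2) \<delta>) x $ i $ j
       | (None, None) \<Rightarrow> scaled_wendland k \<delta> x
       | _ \<Rightarrow> 0)"

definition stokes_op :: "real \<Rightarrow> (real^'n \<Rightarrow> real^('n option)) \<Rightarrow> real^'n \<Rightarrow> real^'n" where
  "stokes_op \<nu> v x =
     (\<chi> i. - \<nu> * (\<Sum>j\<in>UNIV. partial_deriv j (partial_deriv j (\<lambda>y. v y $ Some i)) x)
           + partial_deriv i (\<lambda>y. v y $ None) x)"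

(* xi_{i,j}: collocation of the differential operator at the interior centres j <= N,
   evaluation of the velocity at the boundary centres j > N *)
definition colloc_functional ::
    "real \<Rightarrow> nat \<Rightarrow> (nat \<Rightarrow> real^'n) \<Rightarrow> 'n \<Rightarrow> nat \<Rightarrow> (real^'n \<Rightarrow> real^('n option)) \<Rightarrow> real" where
  "colloc_functional \<nu> N X i j v =
     (if j \<le> N then stokes_op \<nu> v (X j) $ i else v (X j) $ Some i)"

definition colloc_entry ::
    "nat \<Rightarrow> real \<Rightarrow> real \<Rightarrow> nat \<Rightarrow> (nat \<Rightarrow> real^'n) \<Rightarrow> 'n \<times> nat \<Rightarrow> 'n \<times> nat \<Rightarrow> real" where
  "colloc_entry k \<nu> \<delta> N X p q =
     colloc_functional \<nu> N X (fst p) (snd p)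
       (\<lambda>x. \<chi> r. colloc_functional \<nu> N X (fst q) (snd q)
                   (\<lambda>y. stokes_kernel k \<delta> (x - y) $ r))"

(* Rows and columns are indexed by pairs (i, j), enumerated in an arbitrary but common order;
   the eigenvalues do not depend on it. *)
definition colloc_matrix ::
    "nat \<Rightarrow> real \<Rightarrow> real \<Rightarrow> nat \<Rightarrow> nat \<Rightarrow> (nat \<Rightarrow> real^'n) \<Rightarrow> real mat" where
  "colloc_matrix k \<nu> \<delta> N M X =
     Matrix.mat (CARD('n) * M) (CARD('n) * M)
       (\<lambda>(a, b). colloc_entry k \<nu> \<delta> N X
          (from_nat_into (UNIV \<times> {1..M}) a) (from_nat_into (UNIV \<times> {1..M}) b))"

definition lambda_max :: "real mat \<Rightarrow> real" where
  "lambda_max A = Max (spectrum A)"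

end

theory Submission
  imports Defs
begin

text \<open>
  By scaling, the entries of the collocation matrix are \<open>\<delta>\<^bsup>-d-2\<^esup>\<close>, \<open>\<delta>\<^bsup>-d-4\<^esup>\<close> and \<open>\<delta>\<^bsup>-d-6\<^esup>\<close> times
  derivatives of the unscaled kernels: order at most six for \<open>\<psi>\<^bsub>\<tau>+1\<^esub>\<close> and two for \<open>\<psi>\<^bsub>\<tau>-1\<^esub>\<close>. These
  derivatives are continuous with compact support, hence bounded, so that the row sums, and with them
  every eigenvalue, are at most a constant times \<open>d M max (\<delta>\<^bsup>-d-2\<^esup>) (\<delta>\<^bsup>-d-6\<^esup>)\<close>, and \<open>M\<close> is bounded by
  assumption. The smoothness comes from the recursion \<open>\<partial>\<^sub>i \<psi>\<^bsub>l,k\<^esub>(|x|) = - x\<^sub>i \<psi>\<^bsub>l,k-1\<^esub>(|x|)\<close>. Symmetry of the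
  matrix is also needed: it guarantees that the maximum over the real spectrum is not taken over the
  empty set.
\<close>

section \<open>Wendland functions on the line\<close>

text \<open>Radial formulas break at two places: at the origin, where the norm is not
  differentiable, and on the unit sphere, where the profile is cut off. The sphere is harmless
  because the profiles vanish at 1 to high order. The origin is the obstacle: an entry takes six
  derivatives of the kernel with parameter k + 2, two in the divergence-free part and two for each
  Laplacian of the Stokes operator, but the recursion runs out after k + 2 steps. For k = 2 the last
  two derivatives fall on products x^alpha (1 - |x|)_+^l, whose second factor has a conical point at
  0. The monomial saves them: every step of the recursion contributes a factor x_i, and this zero
  compensates the singularity.\<close>

lemma power_mult_one_minus_antiderivative:
  obtains B :: "real \<Rightarrow> real" where "\<And>r. (B has_real_derivative r ^ m * (1 - r) ^ l) (at r)"
proof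
  fix r :: real
  \<comment> \<open>The binomial expansion of r^m (1 - r)^l, integrated term by term.\<close>
  let ?B = "\<lambda>r::real. \<Sum>i\<le>l. of_nat (l choose i) * (-1) ^ i * (r ^ (m + i + 1) / (m + i + 1))"
  have "(?B has_real_derivative (\<Sum>i\<le>l. of_nat (l choose i) * (-1) ^ i * r ^ (m + i))) (at r)"
  proof (rule DERIV_sum)
    fix i
    have "((\<lambda>r::real. r ^ (m + i + 1) / (m + i + 1)) has_real_derivative
        real (m + i + 1) * r ^ (m + i) / (m + i + 1)) (at r)"
      using DERIV_cdivide[OF DERIV_pow[of "m + i + 1" r], of "real (m + i + 1)"]
      by (simp only: Suc_eq_plus1[symmetric] diff_Suc_Suc diff_zero)
    then have "((\<lambda>r::real. r ^ (m + i + 1) / (m + i + 1)) has_real_derivative r ^ (m + i)) (at r)"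
      by (simp only: nonzero_mult_div_cancel_left of_nat_eq_0_iff add_is_0 one_neq_zero simp_thms not_False_eq_True)
    then show "((\<lambda>r. of_nat (l choose i) * (-1) ^ i * (r ^ (m + i + 1) / (m + i + 1))) has_real_derivative
        of_nat (l choose i) * (-1) ^ i * r ^ (m + i)) (at r)"
      by (rule DERIV_cmult)
  qed
  also have "(\<Sum>i\<le>l. of_nat (l choose i) * (-1) ^ i * r ^ (m + i)) =
      r ^ m * (\<Sum>i\<le>l. of_nat (l choose i) * (- r) ^ i * 1 ^ (l - i))"
    unfolding sum_distrib_left
    by (intro sum.cong refl) (simp add: power_minus[of r] power_add mult_ac)
  also have "\<dots> = r ^ m * (1 - r) ^ l"
    using binomial_ring[of "- r" 1 l] by simp
  finally show "(?B has_real_derivative r ^ m * (1 - r) ^ l) (at r)" .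
qed

text \<open>
  With \<open>D i r = \<integral>\<^sub>r\<^sup>1 s\<^bsup>2i+1\<^esup> w(s) ds\<close> the sum is the Wendland integral
  \<open>\<integral>\<^sub>r\<^sup>1 s w(s) (s\<^sup>2 - r\<^sup>2)\<^bsup>k+1\<^esup> ds\<close>; the terms in which \<open>D i\<close> is differentiated add up to a
  multiple of \<open>(r\<^sup>2 - r\<^sup>2)\<^bsup>k+1\<^esup> = 0\<close>.
\<close>

lemma binomial_moment_derivative:
  fixes D :: "nat \<Rightarrow> real \<Rightarrow> real"
  assumes "\<And>i r. (D i has_real_derivative - (r ^ (2 * i + 1) * w r)) (at r)"
  shows "((\<lambda>r. \<Sum>i\<le>Suc k. of_nat (Suc k choose i) * (- (r\<^sup>2)) ^ (Suc k - i) * D i r) has_real_derivative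
      - 2 * r * real (Suc k) * (\<Sum>i\<le>k. of_nat (k choose i) * (- (r\<^sup>2)) ^ (k - i) * D i r)) (at r)"
proof -
  have "((\<lambda>r. \<Sum>i\<le>Suc k. of_nat (Suc k choose i) * (- (r\<^sup>2)) ^ (Suc k - i) * D i r) has_real_derivative
     (\<Sum>i\<le>Suc k. of_nat (Suc k choose i) * (real (Suc k - i) * (- (r\<^sup>2)) ^ (Suc k - i - 1) * (- 2 * r) * D i r
       + (- (r\<^sup>2)) ^ (Suc k - i) * - (r ^ (2 * i + 1) * w r)))) (at r)"
    by (rule DERIV_sum) (auto intro!: derivative_eq_intros assms simp: algebra_simps)
  also have "(\<Sum>i\<le>Suc k. of_nat (Suc k choose i) * (real (Suc k - i) * (- (r\<^sup>2)) ^ (Suc k - i - 1) * (- 2 * r) * D i r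
       + (- (r\<^sup>2)) ^ (Suc k - i) * - (r ^ (2 * i + 1) * w r))) =
     (\<Sum>i\<le>Suc k. - 2 * r * (real ((Suc k - i) * (Suc k choose i)) * (- (r\<^sup>2)) ^ (Suc k - i - 1) * D i r))
     - r * w r * (\<Sum>i\<le>Suc k. of_nat (Suc k choose i) * (r\<^sup>2) ^ i * (- (r\<^sup>2)) ^ (Suc k - i))"
  proof -
    have *: "c * (x * P * (- 2 * r) * d + Q * - (r ^ (2 * i + 1) * w r)) =
        - 2 * r * ((x * c) * P * d) - r * w r * (c * (r\<^sup>2) ^ i * Q)" for c x P Q d and i :: nat
      by (simp add: power_mult[symmetric] algebra_simps)
    show ?thesis
      unfolding sum_distrib_left sum_subtractf[symmetric] * of_nat_mult ..
  qed
  also have "(\<Sum>i\<le>Suc k. of_nat (Suc k choose i) * (r\<^sup>2) ^ i * (- (r\<^sup>2)) ^ (Suc k - i)) = 0"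
    using binomial_ring[of "r\<^sup>2" "- (r\<^sup>2)" "Suc k"] by simp
  also have "(\<Sum>i\<le>Suc k. - 2 * r * (real ((Suc k - i) * (Suc k choose i)) * (- (r\<^sup>2)) ^ (Suc k - i - 1) * D i r))
     = (\<Sum>i\<le>k. - 2 * r * (real (Suc k * (k choose i)) * (- (r\<^sup>2)) ^ (k - i) * D i r))"
  proof -
    \<comment> \<open>Absorption turns the exponent brought down by differentiation into the common
      factor k + 1.\<close>
    have "(Suc k - i) * (Suc k choose i) = Suc k * (k choose i)" for i
      using binomial_absorb_comp[of "Suc k" i] by simp
    then show ?thesis
      by (simp add: binomial_eq_0)
  qed
  also have "\<dots> = - 2 * r * real (Suc k) * (\<Sum>i\<le>k. of_nat (k choose i) * (- (r\<^sup>2)) ^ (k - i) * D i r)"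
    unfolding sum_distrib_left by (intro sum.cong refl) (simp only: of_nat_mult mult_ac)
  finally show ?thesis
    by simp
qed

text \<open>The factor 1 / (Gamma(k) 2^(k-1)) in the definition is exactly what cancels the 2 (k +
  1) of each differentiation. The \<open>q j\<close> live on the whole line, without the cutoff, so
  that two-sided derivatives exist at 0 and at 1.\<close>

lemma wendland_recursion:
  obtains q :: "nat \<Rightarrow> real \<Rightarrow> real" where
    "\<And>r. q 0 r = (1 - r) ^ l"
    "\<And>j r. (q (Suc j) has_real_derivative - r * q j r) (at r)"
    "\<And>j. q (Suc j) 1 = 0"
    "\<And>j r. r \<le> 1 \<Longrightarrow> wendland l (Suc j) r = q (Suc j) r"
proof -
  have "\<exists>B. \<forall>r::real. (B has_real_derivative r ^ m * (1 - r) ^ l) (at r)" for m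
    by (rule power_mult_one_minus_antiderivative[of m l]) blast
  then obtain B :: "nat \<Rightarrow> real \<Rightarrow> real"
    where B: "\<And>m r. (B m has_real_derivative r ^ m * (1 - r) ^ l) (at r)"
    by metis
  define D where "D i r = B (2 * i + 1) 1 - B (2 * i + 1) r" for i r
  have D: "(D i has_real_derivative - (r ^ (2 * i + 1) * (1 - r) ^ l)) (at r)" for i r
    unfolding D_def by (auto intro!: derivative_eq_intros B)
  define I where "I k r = (\<Sum>i\<le>k. of_nat (k choose i) * (- (r\<^sup>2)) ^ (k - i) * D i r)" for k r
  have I0: "(I 0 has_real_derivative - r * (1 - r) ^ l) (at r)" for r
    using D[of 0 r] by (simp add: I_def[abs_def])
  have ISuc: "(I (Suc k) has_real_derivative - 2 * r * real (Suc k) * I k r) (at r)" for k r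
    unfolding I_def using binomial_moment_derivative[of D, OF D] .
  have I_integral: "integral {r..1} (\<lambda>s. s * (1 - s) ^ l * (s\<^sup>2 - r\<^sup>2) ^ k) = I k r" if "r \<le> 1" for k r
  proof (rule integral_unique)
    \<comment> \<open>The power (s^2 - r^2)^k is expanded with r frozen, so that each term is a
      constant times an antiderivative in s.\<close>
    let ?P = "\<lambda>s. \<Sum>i\<le>k. of_nat (k choose i) * (- (r\<^sup>2)) ^ (k - i) * B (2 * i + 1) s"
    have "((\<lambda>s. s * (1 - s) ^ l * (s\<^sup>2 - r\<^sup>2) ^ k) has_integral ?P 1 - ?P r) {r..1}"
    proof (rule fundamental_theorem_of_calculus[OF that])
      fix s
      have "(?P has_real_derivative (\<Sum>i\<le>k. of_nat (k choose i) * (- (r\<^sup>2)) ^ (k - i) *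
          (s ^ (2 * i + 1) * (1 - s) ^ l))) (at s within {r..1})"
        by (rule DERIV_sum) (auto intro!: derivative_eq_intros DERIV_subset[OF B])
      also have "(\<Sum>i\<le>k. of_nat (k choose i) * (- (r\<^sup>2)) ^ (k - i) * (s ^ (2 * i + 1) * (1 - s) ^ l))
        = s * (1 - s) ^ l * (\<Sum>i\<le>k. of_nat (k choose i) * (s\<^sup>2) ^ i * (- (r\<^sup>2)) ^ (k - i))"
        unfolding sum_distrib_left
        by (intro sum.cong refl) (simp add: power_mult)
      also have "\<dots> = s * (1 - s) ^ l * (s\<^sup>2 - r\<^sup>2) ^ k"
        using binomial_ring[of "s\<^sup>2" "- (r\<^sup>2)" k] by simp
      finally show "(?P has_vector_derivative s * (1 - s) ^ l * (s\<^sup>2 - r\<^sup>2) ^ k) (at s within {r..1})"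
        by (simp add: has_real_derivative_iff_has_vector_derivative)
    qed
    also have "?P 1 - ?P r = I k r"
      by (simp add: I_def D_def sum_subtractf[symmetric] algebra_simps)
    finally show "((\<lambda>s. s * (1 - s) ^ l * (s\<^sup>2 - r\<^sup>2) ^ k) has_integral I k r) {r..1}" .
  qed
  define q where "q j r = (case j of 0 \<Rightarrow> (1 - r) ^ l | Suc k \<Rightarrow> I k r / (fact k * 2 ^ k))" for j r
  show ?thesis
  proof (rule that[of q])
    show "q 0 r = (1 - r) ^ l" for r
      by (simp add: q_def)
    show "(q (Suc j) has_real_derivative - r * q j r) (at r)" for j r
    proof (cases j)
      case 0
      then show ?thesis
        using I0 by (simp add: q_def[abs_def])
    next
      case (Suc k)
      have "((\<lambda>r. I (Suc k) r / (fact (Suc k) * 2 ^ Suc k)) has_real_derivative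
          (- 2 * r * real (Suc k) * I k r) / (fact (Suc k) * 2 ^ Suc k)) (at r)"
        by (rule DERIV_cdivide[OF ISuc])
      moreover have "(- 2 * r * real (Suc k) * I k r) / (fact (Suc k) * 2 ^ Suc k) = - r * (I k r / (fact k * 2 ^ k))"
        by (simp add: divide_simps del: of_nat_Suc)
      ultimately show ?thesis
        by (simp add: q_def[abs_def] Suc)
    qed
    show "q (Suc j) 1 = 0" for j
      by (simp add: q_def I_def D_def)
    show "wendland l (Suc j) r = q (Suc j) r" if "r \<le> 1" for j r
      using that Gamma_fact[of j, where 'a=real]
      by (simp add: wendland_def q_def I_integral add_ac)
  qed
qed

text \<open>Only r = 1 needs an argument: there every difference quotient of the truncated function
  is zero or that of \<open>q\<close>, and the latter tends to \<open>q' 1 = 0\<close>.\<close>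

lemma has_real_derivative_cutoff:
  fixes q :: "real \<Rightarrow> real"
  assumes q: "\<And>r. (q has_real_derivative q' r) (at r)" and "q 1 = 0" "q' 1 = 0"
  shows "((\<lambda>r. if r \<le> 1 then q r else 0) has_real_derivative (if r \<le> 1 then q' r else 0)) (at r)"
proof -
  let ?f = "\<lambda>r. if r \<le> 1 then q r else 0"
  consider "r < 1" | "r = 1" | "r > 1" by linarith
  then show ?thesis
  proof cases
    case 1
    have "(?f has_real_derivative q' r) (at r)"
      by (rule has_field_derivative_transform_within_open[OF q[of r], of "{..<1}"]) (use 1 in auto)
    with 1 show ?thesis by simp
  next
    case 2
    have le: "norm ((?f y - ?f 1) / (y - 1)) \<le> \<bar>(q y - q 1) / (y - 1)\<bar>" for y
      by (cases "y \<le> 1") (simp_all add: \<open>q 1 = 0\<close>)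
    have lim: "((\<lambda>y. (q y - q 1) / (y - 1)) \<longlongrightarrow> 0) (at 1)"
      using q[of 1] unfolding has_field_derivative_iff \<open>q' 1 = 0\<close> .
    have "((\<lambda>y. (?f y - ?f 1) / (y - 1)) \<longlongrightarrow> 0) (at 1)"
      by (rule Lim_null_comparison[OF _ tendsto_rabs_zero[OF lim]]) (rule always_eventually, rule allI, rule le)
    then show ?thesis
      unfolding has_field_derivative_iff 2 using \<open>q' 1 = 0\<close> by simp
  next
    case 3
    have "(?f has_real_derivative 0) (at r)"
      by (rule has_field_derivative_transform_within_open[of "\<lambda>_. 0" 0 r "{1<..}"]) (use 3 in auto)
    with 3 show ?thesis by simp
  qed
qed

section \<open>Partial derivatives and functions supported in the unit ball\<close>

text \<open>Full differentiability and not just existence of the partial derivatives, since the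
  chain rule and continuity depend on it. The gradient is listed by components so that each is again
  a real function to which the notion applies.\<close>

definition has_partials :: "(real^'n \<Rightarrow> real) \<Rightarrow> ('n \<Rightarrow> real^'n \<Rightarrow> real) \<Rightarrow> bool" where
  "has_partials f g \<longleftrightarrow> (\<forall>x. (f has_derivative (\<lambda>h. \<Sum>i\<in>UNIV. h $ i * g i x)) (at x))"

lemma has_partials_imp_partial_deriv:
  fixes f :: "real^'n \<Rightarrow> real"
  assumes "has_partials f g"
  shows "partial_deriv i f = g i"
proof
  fix x :: "real^'n"
  have "((\<lambda>t::real. x + t *\<^sub>R axis i 1) has_derivative (\<lambda>t. t *\<^sub>R axis i 1)) (at 0)"
    by (auto intro!: derivative_eq_intros)
  moreover have "(f has_derivative (\<lambda>h. \<Sum>j\<in>UNIV. h $ j * g j x)) (at (x + 0 *\<^sub>R axis i 1))"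
    using assms by (simp add: has_partials_def)
  ultimately have "((\<lambda>t. f (x + t *\<^sub>R axis i 1)) has_derivative
      (\<lambda>t. \<Sum>j\<in>UNIV. (t *\<^sub>R axis i 1 :: real^'n) $ j * g j x)) (at 0)"
    by (rule has_derivative_compose)
  also have "(\<lambda>t. \<Sum>j\<in>UNIV. (t *\<^sub>R axis i 1 :: real^'n) $ j * g j x) = (*) (g i x)"
    by (auto simp: axis_def if_distrib[of "\<lambda>u. _ * u * _"] if_distrib[of "\<lambda>u. u * _"] cong: if_cong)
  finally show "partial_deriv i f x = g i x"
    unfolding partial_deriv_def has_field_derivative_def[symmetric] by (rule DERIV_imp_deriv)
qed

lemma has_partials_add:
  fixes f g :: "real^'n \<Rightarrow> real"
  assumes "has_partials f f'" "has_partials g g'"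
  shows "has_partials (\<lambda>x. f x + g x) (\<lambda>i x. f' i x + g' i x)"
  unfolding has_partials_def
proof
  fix x :: "real^'n"
  have "((\<lambda>x. f x + g x) has_derivative
      (\<lambda>h. (\<Sum>i\<in>UNIV. h $ i * f' i x) + (\<Sum>i\<in>UNIV. h $ i * g' i x))) (at x)"
    using assms unfolding has_partials_def by (intro has_derivative_add) simp_all
  then show "((\<lambda>x. f x + g x) has_derivative (\<lambda>h. \<Sum>i\<in>UNIV. h $ i * (f' i x + g' i x))) (at x)"
    by (simp only: sum.distrib distrib_left)
qed

lemma has_partials_mult:
  fixes f g :: "real^'n \<Rightarrow> real"
  assumes "has_partials f f'" "has_partials g g'"
  shows "has_partials (\<lambda>x. f x * g x) (\<lambda>i x. f' i x * g x + f x * g' i x)"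
  unfolding has_partials_def
proof
  fix x :: "real^'n"
  have "((\<lambda>x. f x * g x) has_derivative
      (\<lambda>h. f x * (\<Sum>i\<in>UNIV. h $ i * g' i x) + (\<Sum>i\<in>UNIV. h $ i * f' i x) * g x)) (at x)"
    using assms unfolding has_partials_def by (intro has_derivative_mult) simp_all
  then show "((\<lambda>x. f x * g x) has_derivative (\<lambda>h. \<Sum>i\<in>UNIV. h $ i * (f' i x * g x + f x * g' i x))) (at x)"
    by (simp add: sum.distrib sum_distrib_left sum_distrib_right distrib_left mult_ac add_ac)
qed

lemma has_partials_const: "has_partials (\<lambda>x. c) (\<lambda>i x. 0)"
  by (simp add: has_partials_def)

lemma has_partials_component: "has_partials (\<lambda>x::real^'n. x $ j) (\<lambda>i x. if i = j then 1 else 0)"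
proof -
  have "((\<lambda>x::real^'n. x $ j) has_derivative (\<lambda>h. h $ j)) (at x)" for x :: "real^'n"
    by (rule bounded_linear_imp_has_derivative) (rule bounded_linear_vec_nth)
  moreover have "(\<lambda>h::real^'n. h $ j) = (\<lambda>h. \<Sum>i\<in>UNIV. h $ i * (if i = j then 1 else 0))"
    by (simp add: if_distrib cong: if_cong)
  ultimately show ?thesis
    unfolding has_partials_def by metis
qed

lemma has_partials_continuous: "has_partials f g \<Longrightarrow> continuous_on UNIV f"
  unfolding has_partials_def
  by (meson continuous_at_imp_continuous_on has_derivative_continuous)

text \<open>The support condition is part of every level, so that all derivatives up to order n are
  bounded. Continuity is asked for at the last level only; at the others it follows from
  differentiability.\<close>

primrec Cn_unit_ball :: "nat \<Rightarrow> (real^'n \<Rightarrow> real) \<Rightarrow> bool" where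
  "Cn_unit_ball 0 f \<longleftrightarrow> continuous_on UNIV f \<and> (\<forall>x. 1 < norm x \<longrightarrow> f x = 0)"
| "Cn_unit_ball (Suc n) f \<longleftrightarrow> (\<forall>x. 1 < norm x \<longrightarrow> f x = 0) \<and>
     (\<exists>g. has_partials f g \<and> (\<forall>i. Cn_unit_ball n (g i)))"

lemma Cn_unit_ball_support: "Cn_unit_ball n f \<Longrightarrow> 1 < norm x \<Longrightarrow> f x = 0"
  by (cases n) auto

lemma Cn_unit_ball_continuous: "Cn_unit_ball n f \<Longrightarrow> continuous_on UNIV f"
  by (cases n) (auto intro: has_partials_continuous)

lemma Cn_unit_ball_SucI:
  assumes "\<And>x. 1 < norm x \<Longrightarrow> f x = 0" "has_partials f g" "\<And>i. Cn_unit_ball n (g i)"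
  shows "Cn_unit_ball (Suc n) f"
  using assms unfolding Cn_unit_ball.simps by blast

lemma Cn_unit_ball_SucE:
  assumes "Cn_unit_ball (Suc n) f"
  obtains g where "has_partials f g" "\<And>i. Cn_unit_ball n (g i)"
  using assms unfolding Cn_unit_ball.simps by blast

lemma Cn_unit_ball_add:
  assumes "Cn_unit_ball n f" "Cn_unit_ball n g"
  shows "Cn_unit_ball n (\<lambda>x. f x + g x)"
  using assms
proof (induction n arbitrary: f g)
  case 0
  then show ?case by (simp add: continuous_on_add)
next
  case (Suc n)
  obtain f' where f': "has_partials f f'" "\<And>i. Cn_unit_ball n (f' i)"
    using Suc.prems(1) by (rule Cn_unit_ball_SucE) (rule that)
  obtain g' where g': "has_partials g g'" "\<And>i. Cn_unit_ball n (g' i)"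
    using Suc.prems(2) by (rule Cn_unit_ball_SucE) (rule that)
  show ?case
  proof (rule Cn_unit_ball_SucI)
    show "has_partials (\<lambda>x. f x + g x) (\<lambda>i x. f' i x + g' i x)"
      by (rule has_partials_add[OF f'(1) g'(1)])
    show "Cn_unit_ball n (\<lambda>x. f' i x + g' i x)" for i
      by (rule Suc.IH[OF f'(2) g'(2)])
  qed (simp add: Suc.prems[THEN Cn_unit_ball_support])
qed

lemma Cn_unit_ball_cmult:
  assumes "Cn_unit_ball n f"
  shows "Cn_unit_ball n (\<lambda>x. c * f x)"
  using assms
proof (induction n arbitrary: f)
  case 0
  then show ?case by (simp add: continuous_on_mult_left)
next
  case (Suc n)
  obtain f' where f': "has_partials f f'" "\<And>i. Cn_unit_ball n (f' i)"
    using Suc.prems by (rule Cn_unit_ball_SucE) (rule that)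
  show ?case
  proof (rule Cn_unit_ball_SucI)
    show "has_partials (\<lambda>x. c * f x) (\<lambda>i x. c * f' i x)"
      using has_partials_mult[OF has_partials_const[of c] f'(1)] by simp
    show "Cn_unit_ball n (\<lambda>x. c * f' i x)" for i
      by (rule Suc.IH[OF f'(2)])
  qed (simp add: Suc.prems[THEN Cn_unit_ball_support])
qed

lemma Cn_unit_ball_zero: "Cn_unit_ball n (\<lambda>x. 0)"
proof (induction n)
  case (Suc n)
  show ?case
    by (rule Cn_unit_ball_SucI[where g = "\<lambda>i x. 0"]) (simp_all add: has_partials_const Suc)
qed simp

lemma Cn_unit_ball_sum:
  assumes "\<And>j. j \<in> A \<Longrightarrow> Cn_unit_ball n (f j)"
  shows "Cn_unit_ball n (\<lambda>x. \<Sum>j\<in>A. f j x)"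
  using assms
proof (induction A rule: infinite_finite_induct)
  case (insert a A)
  then show ?case
    using Cn_unit_ball_add[of n "f a" "\<lambda>x. \<Sum>j\<in>A. f j x"] by simp
qed (simp_all add: Cn_unit_ball_zero)

lemma Cn_unit_ball_has_partials:
  assumes "Cn_unit_ball (Suc n) f"
  shows "has_partials f (\<lambda>i. partial_deriv i f)"
proof -
  from assms obtain g where g: "has_partials f g"
    by (rule Cn_unit_ball_SucE) (rule that)
  with has_partials_imp_partial_deriv[OF g] show ?thesis
    by simp
qed

lemma Cn_unit_ball_partial_deriv:
  assumes "Cn_unit_ball (Suc n) f"
  shows "Cn_unit_ball n (partial_deriv i f)"
proof -
  from assms obtain g where g: "has_partials f g" "\<And>i. Cn_unit_ball n (g i)"
    by (rule Cn_unit_ball_SucE) (rule that)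
  then show ?thesis
    by (simp add: has_partials_imp_partial_deriv[OF g(1)])
qed

lemma Cn_unit_ball_laplacian:
  assumes "Cn_unit_ball (Suc (Suc n)) f"
  shows "Cn_unit_ball n (laplacian f)"
  unfolding laplacian_def[abs_def]
  by (rule Cn_unit_ball_sum) (rule Cn_unit_ball_partial_deriv, rule Cn_unit_ball_partial_deriv, rule assms)

lemma Cn_unit_ball_bounded:
  assumes "Cn_unit_ball n f"
  obtains B where "\<And>x. \<bar>f x\<bar> \<le> B"
proof -
  have "compact (f ` cball 0 1)"
    using Cn_unit_ball_continuous[OF assms] continuous_on_subset
    by (intro compact_continuous_image) auto
  then obtain B where "\<forall>y\<in>f ` cball 0 1. norm y \<le> B"
    using compact_imp_bounded bounded_iff by blast
  then have B: "\<bar>f x\<bar> \<le> B" if "x \<in> cball 0 1" for x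
    using that by auto
  have "\<bar>f x\<bar> \<le> max B 0" for x
    using B[of x] Cn_unit_ball_support[OF assms, of x] by (cases "norm x \<le> 1") auto
  then show ?thesis
    by (rule that)
qed

section \<open>Homogeneous polynomials: derivatives and growth\<close>

inductive homogeneous_poly :: "nat \<Rightarrow> (real^'n \<Rightarrow> real) \<Rightarrow> bool" where
  const: "homogeneous_poly 0 (\<lambda>x. c)"
| component: "homogeneous_poly m p \<Longrightarrow> homogeneous_poly (Suc m) (\<lambda>x. x $ i * p x)"
| add: "homogeneous_poly m p \<Longrightarrow> homogeneous_poly m q \<Longrightarrow> homogeneous_poly m (\<lambda>x. p x + q x)"

lemma homogeneous_poly_zero: "homogeneous_poly m (\<lambda>x. 0)"
proof (induction m)
  case 0
  show ?case by (rule homogeneous_poly.const)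
next
  case (Suc m)
  from homogeneous_poly.component[OF this] show ?case by simp
qed

text \<open>The truncated \<open>m - 1\<close> would spoil the degree count at m = 0: in the product
  rule for \<open>x $ i * p x\<close> the term \<open>x $ i * g j x\<close> then has degree 1 where
  0 is required. The third conclusion removes it.\<close>

lemma homogeneous_poly_partials:
  assumes "homogeneous_poly m p"
  obtains g where "has_partials p g" "\<And>i. homogeneous_poly (m - 1) (g i)" "\<And>i. m = 0 \<Longrightarrow> g i = (\<lambda>x. 0)"
proof -
  from assms have "\<exists>g. has_partials p g \<and> (\<forall>i. homogeneous_poly (m - 1) (g i) \<and> (m = 0 \<longrightarrow> g i = (\<lambda>x. 0)))"
  proof (induction rule: homogeneous_poly.induct)
    case (const c)
    show ?case
      by (intro exI[of _ "\<lambda>i x. 0"]) (simp add: has_partials_const homogeneous_poly_zero)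
  next
    case (component m p i)
    then obtain g where g: "has_partials p g" "\<And>j. homogeneous_poly (m - 1) (g j)"
      "\<And>j. m = 0 \<longrightarrow> g j = (\<lambda>x. 0)" by auto
    have "homogeneous_poly m (\<lambda>x. (if j = i then 1 else 0) * p x + x $ i * g j x)" for j
    proof (rule homogeneous_poly.add)
      show "homogeneous_poly m (\<lambda>x. (if j = i then 1 else 0) * p x)"
        using component.hyps homogeneous_poly_zero[of m] by auto
      show "homogeneous_poly m (\<lambda>x. x $ i * g j x)"
        using homogeneous_poly.component[OF g(2)[of j], of i] g(3)[of j] homogeneous_poly_zero[of 0]
        by (cases m) auto
    qed
    then show ?case
      using has_partials_mult[OF has_partials_component[of i] g(1)]
      by (intro exI[of _ "\<lambda>j x. (if j = i then 1 else 0) * p x + x $ i * g j x"]) auto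
  next
    case (add m p q)
    then obtain g h where g: "has_partials p g" "\<And>j. homogeneous_poly (m - 1) (g j)"
      "\<And>j. m = 0 \<longrightarrow> g j = (\<lambda>x. 0)"
      and h: "has_partials q h" "\<And>j. homogeneous_poly (m - 1) (h j)"
      "\<And>j. m = 0 \<longrightarrow> h j = (\<lambda>x. 0)" by auto
    have "homogeneous_poly (m - 1) (\<lambda>x. g j x + h j x)" for j
      by (rule homogeneous_poly.add[OF g(2) h(2)])
    with g(3) h(3) show ?case
      by (intro exI[of _ "\<lambda>j x. g j x + h j x"] conjI has_partials_add[OF g(1) h(1)]) simp
  qed
  then obtain g where g: "has_partials p g"
      "\<forall>i. homogeneous_poly (m - 1) (g i) \<and> (m = 0 \<longrightarrow> g i = (\<lambda>x. 0))"
    by (elim exE conjE)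
  show ?thesis
    by (rule that[OF g(1)]) (use g(2) in blast)+
qed

lemma homogeneous_poly_bound:
  assumes "homogeneous_poly m p"
  obtains C where "C \<ge> 0" "\<And>x. \<bar>p x\<bar> \<le> C * norm x ^ m"
proof -
  from assms have "\<exists>C\<ge>0. \<forall>x. \<bar>p x\<bar> \<le> C * norm x ^ m"
  proof (induction rule: homogeneous_poly.induct)
    case (const c)
    show ?case by (intro exI[of _ "\<bar>c\<bar>"]) auto
  next
    case (component m p i)
    then obtain C where C: "C \<ge> 0" "\<And>x. \<bar>p x\<bar> \<le> C * norm x ^ m" by auto
    have "\<bar>x $ i * p x\<bar> \<le> norm x * (C * norm x ^ m)" for x
      unfolding abs_mult by (intro mult_mono C component_le_norm_cart) auto
    with C show ?case by (intro exI[of _ C]) (auto simp: mult_ac)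
  next
    case (add m p q)
    then obtain C D where "C \<ge> 0" "\<And>x. \<bar>p x\<bar> \<le> C * norm x ^ m"
      "D \<ge> 0" "\<And>x. \<bar>q x\<bar> \<le> D * norm x ^ m" by auto
    then have "\<bar>p x + q x\<bar> \<le> C * norm x ^ m + D * norm x ^ m" for x
      by (meson abs_triangle_ineq add_mono order_trans)
    with \<open>C \<ge> 0\<close> \<open>D \<ge> 0\<close> show ?case
      by (intro exI[of _ "C + D"]) (auto simp: algebra_simps)
  qed
  with that show ?thesis by auto
qed

text \<open>A profile derivative of the form \<open>- norm x * \<sigma>\<close> cancels the 1 / |x|
  in the gradient of the norm and leaves a polynomial factor.\<close>

lemma radial_has_derivative:
  fixes x :: "real^'n"
  assumes "(\<rho> has_real_derivative - norm x * \<sigma>) (at (norm x))" and "x \<noteq> 0"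
  shows "((\<lambda>x. \<rho> (norm x)) has_derivative (\<lambda>h. \<Sum>i\<in>UNIV. h $ i * (- x $ i * \<sigma>))) (at x)"
proof -
  have "(norm has_derivative (\<lambda>h. inner h (sgn x))) (at x)"
    using assms(2) by (rule has_derivative_norm)
  moreover have "(\<rho> has_derivative (*) (- norm x * \<sigma>)) (at (norm x))"
    using assms(1) by (simp add: has_field_derivative_def)
  ultimately have "((\<lambda>x. \<rho> (norm x)) has_derivative (\<lambda>h. - norm x * \<sigma> * inner h (sgn x))) (at x)"
    by (rule has_derivative_compose)
  also have "(\<lambda>h. - norm x * \<sigma> * inner h (sgn x)) = (\<lambda>h. \<Sum>i\<in>UNIV. h $ i * (- x $ i * \<sigma>))"
    unfolding inner_vec_def sum_distrib_left
    by (intro ext sum.cong refl) (use assms(2) in \<open>simp add: sgn_div_norm field_simps\<close>)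
  finally show ?thesis .
qed

lemma radial_has_partials:
  assumes \<rho>: "\<And>r. (\<rho> has_real_derivative - r * \<sigma> r) (at r)"
  shows "has_partials (\<lambda>x. \<rho> (norm x)) (\<lambda>i x. - x $ i * \<sigma> (norm x))"
  unfolding has_partials_def
proof
  fix x :: "real^'n"
  show "((\<lambda>x. \<rho> (norm x)) has_derivative (\<lambda>h. \<Sum>i\<in>UNIV. h $ i * (- x $ i * \<sigma> (norm x)))) (at x)"
  proof (cases "x = 0")
    case False
    then show ?thesis
      by (intro radial_has_derivative \<rho>)
  next
    case True
    \<comment> \<open>The derivative of the profile at 0 is \<open>- 0 * \<sigma> 0 = 0\<close>, so
      the profile varies by o(|x|) and the kink of the norm does no harm.\<close>
    have "\<exists>d>0. \<forall>y::real^'n. norm (y - 0) < d \<longrightarrow> norm (\<rho> (norm y) - \<rho> (norm (0::real^'n)) - 0) \<le> e * norm (y - 0)"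
      if "e > 0" for e
    proof -
      have "(\<rho> has_derivative (*) (- 0 * \<sigma> 0)) (at 0)"
        using \<rho>[of 0] by (simp only: has_field_derivative_def)
      then have "(\<rho> has_derivative (\<lambda>_. 0)) (at 0)"
        by (rule has_derivative_eq_rhs) (simp add: fun_eq_iff)
      then obtain d where d: "d > 0" "\<And>r. \<bar>r\<bar> < d \<Longrightarrow> \<bar>\<rho> r - \<rho> 0\<bar> \<le> e * \<bar>r\<bar>"
        using \<open>e > 0\<close> unfolding has_derivative_at_alt by auto
      show ?thesis
        using d(1) d(2)[of "norm _"] by auto
    qed
    then show ?thesis
      using True by (auto simp: has_derivative_at_alt)
  qed
qed

section \<open>Smoothness of the radial Wendland functions\<close>

lemma truncated_power_has_real_derivative:
  assumes "a \<ge> 1"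
  shows "((\<lambda>r::real. max 0 (1 - r) ^ Suc a) has_real_derivative - real (Suc a) * max 0 (1 - r) ^ a) (at r)"
proof -
  have "((\<lambda>r. if r \<le> 1 then (1 - r) ^ Suc a else 0) has_real_derivative
      (if r \<le> 1 then - real (Suc a) * (1 - r) ^ a else 0)) (at r)"
  proof (rule has_real_derivative_cutoff)
    fix r :: real
    have "((\<lambda>r. (1 - r) ^ Suc a) has_real_derivative real (Suc a) * (1 - r) ^ a * (0 - 1)) (at r)"
      using DERIV_power[where n = "Suc a", OF DERIV_diff[OF DERIV_const[of 1] DERIV_ident], of r UNIV]
      by (simp add: mult_ac)
    moreover have "real (Suc a) * (1 - r) ^ a * (0 - 1) = - real (Suc a) * (1 - r) ^ a"
      by (simp add: algebra_simps)
    ultimately show "((\<lambda>r. (1 - r) ^ Suc a) has_real_derivative - real (Suc a) * (1 - r) ^ a) (at r)"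
      by (simp only:)
  qed (use assms in auto)
  moreover have "(if r \<le> 1 then (1 - r) ^ Suc a else 0) = max 0 (1 - r) ^ Suc a" for r :: real
    by (auto simp: max_def)
  moreover have "(if r \<le> 1 then - real (Suc a) * (1 - r) ^ a else 0) = - real (Suc a) * max 0 (1 - r) ^ a"
    using assms by (auto simp: max_def)
  ultimately show ?thesis
    by simp
qed

lemma inverse_power_has_real_derivative:
  fixes r :: real
  assumes "r > 0"
  shows "((\<lambda>r. inverse r ^ b) has_real_derivative - r * (real b * inverse r ^ (b + 2))) (at r)"
proof -
  have "((\<lambda>r. inverse r ^ b) has_real_derivative real b * inverse r ^ (b - 1) * - (inverse r ^ 2)) (at r)"
    using DERIV_power[OF DERIV_inverse[of r UNIV], of b] assms
    by (simp add: power2_eq_square mult_ac)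
  moreover have "real b * inverse r ^ (b - 1) * - (inverse r ^ 2) = - r * (real b * inverse r ^ (b + 2))"
    using assms by (cases b) (simp_all add: power2_eq_square)
  ultimately show ?thesis
    by (simp only:)
qed

text \<open>
  For \<open>b \<ge> 1\<close> the value at the origin is the junk value \<open>0\<close> of \<open>inverse 0\<close>; it is the correct limit after
  multiplication by a homogeneous polynomial of degree greater than \<open>b\<close>.
\<close>

definition truncated_cone :: "nat \<Rightarrow> nat \<Rightarrow> real^'n \<Rightarrow> real" where
  "truncated_cone a b x = max 0 (1 - norm x) ^ a * inverse (norm x) ^ b"

text \<open>Writing r^-b as r r^-(b+1) puts the derivative into the radial form
  \<open>- r * \<sigma>\<close>. Up to factors x_i the cones are thus closed under differentiation:
  (a + 1, b) leads to (a, b + 1) and (a + 1, b + 2).\<close>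

lemma cone_profile_has_real_derivative:
  fixes r :: real
  assumes "a \<ge> 1" "r > 0"
  shows "((\<lambda>r. max 0 (1 - r) ^ Suc a * inverse r ^ b) has_real_derivative
    - r * (real (Suc a) * (max 0 (1 - r) ^ a * inverse r ^ (b + 1))
      + real b * (max 0 (1 - r) ^ Suc a * inverse r ^ (b + 2)))) (at r)"
proof -
  have "((\<lambda>r. max 0 (1 - r) ^ Suc a * inverse r ^ b) has_real_derivative
     - real (Suc a) * max 0 (1 - r) ^ a * inverse r ^ b
     + - r * (real b * inverse r ^ (b + 2)) * max 0 (1 - r) ^ Suc a) (at r)"
    by (rule DERIV_mult[OF truncated_power_has_real_derivative[OF assms(1)] inverse_power_has_real_derivative[OF assms(2)]])
  moreover have "inverse r ^ b = r * inverse r ^ (b + 1)"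
    using assms(2) by simp
  ultimately show ?thesis
    by (simp only: distrib_left mult_minus_left mult_minus_right mult_ac)
qed

lemma cone_has_derivative:
  assumes "a \<ge> 1" "x \<noteq> 0"
  shows "(truncated_cone (Suc a) b has_derivative (\<lambda>h. \<Sum>i\<in>UNIV. h $ i *
     (- x $ i * (real (Suc a) * truncated_cone a (b + 1) x + real b * truncated_cone (Suc a) (b + 2) x)))) (at x)"
proof -
  have "norm x > 0"
    using assms by simp
  from radial_has_derivative[OF cone_profile_has_real_derivative[OF assms(1) this, of b] assms(2)]
  show ?thesis
    unfolding truncated_cone_def[abs_def] .
qed

text \<open>Away from the origin the product has order m - b \<ge> e. At the origin, b \<ge> 1 makes
  the default value \<open>inverse 0 ^ b\<close> zero, so the bound holds there as well.\<close>

lemma poly_cone_bound: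
  fixes p :: "real^'n \<Rightarrow> real"
  assumes "homogeneous_poly m p" "b \<ge> 1" "b + e \<le> m"
  obtains C where "C \<ge> 0" "\<And>x. norm x < 1 \<Longrightarrow> \<bar>p x * truncated_cone a b x\<bar> \<le> C * norm x ^ e"
proof -
  obtain C where C: "C \<ge> 0" "\<And>x. \<bar>p x\<bar> \<le> C * norm x ^ m"
    using homogeneous_poly_bound[OF assms(1)] by metis
  have "\<bar>p x * truncated_cone a b x\<bar> \<le> C * norm x ^ e" if "norm x < 1" for x
  proof (cases "x = 0")
    case True
    then show ?thesis
      using assms(2) C(1) by (simp add: truncated_cone_def power_0_left)
  next
    case False
    have "\<bar>p x * truncated_cone a b x\<bar> \<le> (C * norm x ^ m) * (1 * inverse (norm x) ^ b)"
      unfolding truncated_cone_def abs_mult using C that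
      by (intro mult_mono) (auto simp: power_le_one power_abs)
    also have "\<dots> = C * norm x ^ (m - b)"
      using False assms(3) by (simp add: power_diff field_simps)
    also have "\<dots> \<le> C * norm x ^ e"
      using that assms(3) C(1) by (intro mult_left_mono power_decreasing) auto
    finally show ?thesis .
  qed
  with C(1) show ?thesis
    by (rule that)
qed

lemma has_derivative_zero_at_0I:
  fixes f :: "real^'n \<Rightarrow> real"
  assumes "\<And>x. norm x < 1 \<Longrightarrow> \<bar>f x\<bar> \<le> C * norm x ^ 2"
  shows "(f has_derivative (\<lambda>_. 0)) (at 0)"
proof -
  have f0: "f 0 = 0"
    using assms[of 0] by simp
  have "\<exists>d>0. \<forall>y. norm (y - 0) < d \<longrightarrow> norm (f y - f 0 - 0) \<le> e * norm (y - 0)" if "e > 0" for e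
  proof (intro exI[of _ "min 1 (e / (\<bar>C\<bar> + 1))"] conjI allI impI)
    show "0 < min 1 (e / (\<bar>C\<bar> + 1))"
      using that by simp
    fix y :: "real^'n" assume y: "norm (y - 0) < min 1 (e / (\<bar>C\<bar> + 1))"
    then have "(\<bar>C\<bar> + 1) * norm y \<le> e"
      by (simp add: pos_less_divide_eq mult_ac)
    moreover have "C * norm y \<le> (\<bar>C\<bar> + 1) * norm y"
      by (intro mult_right_mono) auto
    ultimately have "C * norm y * norm y \<le> e * norm y"
      by (intro mult_right_mono) auto
    with assms[of y] y show "norm (f y - f 0 - 0) \<le> e * norm (y - 0)"
      by (simp add: f0 power2_eq_square mult_ac)
  qed
  then show ?thesis
    by (simp add: has_derivative_at_alt)
qed

text \<open>A differentiation replaces (m, a, b) by (m - 1, a, b), (m + 1, a - 1, b + 1) or (m + 1,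
  a, b + 2), so m - b and a fall by at most one. After n of them there must remain m - b \<ge> 1 for
  continuity at the origin and a \<ge> 1 for the zero at the sphere. For b = 0 there is no negative
  power yet, which saves one degree.\<close>

lemma Cn_unit_ball_cone:
  fixes p :: "real^'n \<Rightarrow> real"
  assumes "homogeneous_poly m p" "n + 1 \<le> a" "if b = 0 then n \<le> m else n + b + 1 \<le> m"
  shows "Cn_unit_ball n (\<lambda>x. p x * truncated_cone a b x)"
  using assms
proof (induction n arbitrary: m p a b)
  case (0 m p a b)
  have p: "continuous_on UNIV p"
    using homogeneous_poly_partials[OF 0(1)] has_partials_continuous by metis
  have "isCont (\<lambda>x. p x * truncated_cone a b x) x" for x
  proof (cases "x = 0 \<and> b \<noteq> 0")
    case False
    have "isCont (\<lambda>x::real^'n. inverse (norm x) ^ b) x"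
      using False by (cases "b = 0") (auto intro!: continuous_intros)
    moreover have "isCont (\<lambda>x::real^'n. max 0 (1 - norm x) ^ a) x"
      by (intro continuous_intros)
    moreover have "isCont p x"
      using p by (simp add: continuous_on_eq_continuous_at)
    ultimately have "isCont (\<lambda>x. p x * (max 0 (1 - norm x) ^ a * inverse (norm x) ^ b)) x"
      by (intro isCont_mult)
    then show ?thesis
      by (simp add: truncated_cone_def)
  next
    case True
    with 0(3) obtain C where C: "\<And>x. norm x < 1 \<Longrightarrow> \<bar>p x * truncated_cone a b x\<bar> \<le> C * norm x ^ 1"
      using poly_cone_bound[OF 0(1), of b 1] by (metis One_nat_def Suc_leI add_0 add_Suc_right neq0_conv)
    have "((\<lambda>x. p x * truncated_cone a b x) \<longlongrightarrow> 0) (at 0)"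
    proof (rule Lim_null_comparison)
      show "eventually (\<lambda>x. norm (p x * truncated_cone a b x) \<le> C * norm x) (at 0)"
        unfolding eventually_at using C by (intro exI[of _ 1]) auto
      show "((\<lambda>x::real^'n. C * norm x) \<longlongrightarrow> 0) (at 0)"
        by (auto intro!: tendsto_eq_intros)
    qed
    with True show ?thesis
      by (simp add: isCont_def truncated_cone_def power_0_left)
  qed
  moreover have "p x * truncated_cone a b x = 0" if "1 < norm x" for x
    using 0(2) that by (simp add: truncated_cone_def)
  ultimately show ?case
    by (simp add: continuous_at_imp_continuous_on)
next
  case (Suc n m p a0 b)
  from Suc.prems(2) obtain a where a: "a0 = Suc a" "n + 1 \<le> a" "1 \<le> a"
    by (cases a0) auto
  obtain g where g: "has_partials p g" "\<And>i. homogeneous_poly (m - 1) (g i)"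
    using homogeneous_poly_partials[OF Suc.prems(1)] by metis
  define G where "G i x = g i x * truncated_cone (Suc a) b x
      + ((- real (Suc a)) * ((x $ i * p x) * truncated_cone a (b + 1) x)
      + (- real b) * ((x $ i * p x) * truncated_cone (Suc a) (b + 2) x))" for i x
  have "((\<lambda>x. p x * truncated_cone (Suc a) b x) has_derivative (\<lambda>h. \<Sum>i\<in>UNIV. h $ i * G i x)) (at x)" for x
  proof (cases "x = 0")
    case False
    have "((\<lambda>x. p x * truncated_cone (Suc a) b x) has_derivative (\<lambda>h.
       p x * (\<Sum>i\<in>UNIV. h $ i * (- x $ i * (real (Suc a) * truncated_cone a (b + 1) x + real b * truncated_cone (Suc a) (b + 2) x)))
       + (\<Sum>i\<in>UNIV. h $ i * g i x) * truncated_cone (Suc a) b x)) (at x)"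
      using g(1) unfolding has_partials_def
      by (intro has_derivative_mult cone_has_derivative a False) simp
    also have "(\<lambda>h. p x * (\<Sum>i\<in>UNIV. h $ i * (- x $ i * (real (Suc a) * truncated_cone a (b + 1) x + real b * truncated_cone (Suc a) (b + 2) x)))
       + (\<Sum>i\<in>UNIV. h $ i * g i x) * truncated_cone (Suc a) b x) = (\<lambda>h. \<Sum>i\<in>UNIV. h $ i * G i x)"
      unfolding sum_distrib_left sum_distrib_right sum.distrib[symmetric] G_def
      by (intro ext sum.cong refl) (simp add: algebra_simps del: of_nat_Suc)
    finally show ?thesis .
  next
    case True
    show ?thesis
    proof (cases "b = 0")
      case False
      \<comment> \<open>The hypothesis gives b + 2 \<le> m, so the product is O(|x|^2). Its
        derivative 0 agrees with \<open>G\<close>, all of whose cones take the default value 0 at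
        the origin.\<close>
      with Suc.prems(3) obtain C where "\<And>x. norm x < 1 \<Longrightarrow> \<bar>p x * truncated_cone (Suc a) b x\<bar> \<le> C * norm x ^ 2"
        using poly_cone_bound[OF Suc.prems(1), of b 2 "Suc a"] by auto
      from has_derivative_zero_at_0I[OF this] True False show ?thesis
        by (simp add: G_def truncated_cone_def)
    next
      case b: True
      obtain C where C: "C \<ge> 0" "\<And>x. \<bar>p x\<bar> \<le> C * norm x ^ m"
        using homogeneous_poly_bound[OF Suc.prems(1)] by metis
      have m: "m \<ge> 1"
        using b Suc.prems(3) by simp
      \<comment> \<open>The cone is replaced by its value 1 at the origin: p vanishes there because
        m \<ge> 1, and Bernoulli's inequality makes the deviation of the cone from 1 linear in |x|.
        The error is quadratic, so the derivative is that of p.\<close>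
      have "\<bar>p x * (truncated_cone (Suc a) 0 x - 1)\<bar> \<le> (C * real (Suc a)) * norm x ^ 2" if "norm x < 1" for x :: "real^'n"
      proof -
        have "\<bar>p x\<bar> \<le> C * norm x ^ 1"
          using C(2)[of x] mult_left_mono[OF power_decreasing[of 1 m "norm x"] C(1)] that m by simp
        moreover have "\<bar>truncated_cone (Suc a) 0 x - 1\<bar> \<le> real (Suc a) * norm x"
          using Bernoulli_inequality[of "- norm x" "Suc a"] that power_le_one[of "1 - norm x" "Suc a"]
          by (simp add: truncated_cone_def max_def algebra_simps del: power_Suc)
        ultimately have "\<bar>p x\<bar> * \<bar>truncated_cone (Suc a) 0 x - 1\<bar> \<le> (C * norm x ^ 1) * (real (Suc a) * norm x)"
          using C(1) by (intro mult_mono) auto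
        then show ?thesis
          by (simp only: abs_mult power2_eq_square power_one_right mult_ac)
      qed
      then have "((\<lambda>x. p x * (truncated_cone (Suc a) 0 x - 1)) has_derivative (\<lambda>_. 0)) (at 0)"
        by (rule has_derivative_zero_at_0I)
      moreover have "(p has_derivative (\<lambda>h. \<Sum>i\<in>UNIV. h $ i * g i 0)) (at 0)"
        using g(1) by (simp add: has_partials_def)
      ultimately have "((\<lambda>x. p x + p x * (truncated_cone (Suc a) 0 x - 1)) has_derivative
          (\<lambda>h. (\<Sum>i\<in>UNIV. h $ i * g i 0) + 0)) (at 0)"
        by (rule has_derivative_add[rotated])
      moreover have "p x + p x * (truncated_cone (Suc a) 0 x - 1) = p x * truncated_cone (Suc a) 0 x" for x
        by (simp add: algebra_simps)
      moreover have "G i 0 = g i 0" for i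
        by (simp add: G_def b truncated_cone_def)
      ultimately show ?thesis
        by (simp add: True b)
    qed
  qed
  then have partials: "has_partials (\<lambda>x. p x * truncated_cone a0 b x) G"
    by (simp add: has_partials_def a)
  have xp: "homogeneous_poly (Suc m) (\<lambda>x. x $ i * p x)" for i
    by (rule homogeneous_poly.component[OF Suc.prems(1)])
  have "Cn_unit_ball n (G i)" for i
  proof -
    have "Cn_unit_ball n (\<lambda>x. g i x * truncated_cone (Suc a) b x)"
      by (rule Suc.IH[OF g(2)]) (use Suc.prems a in \<open>auto split: if_splits\<close>)
    moreover have "Cn_unit_ball n (\<lambda>x. (x $ i * p x) * truncated_cone a (b + 1) x)"
      by (rule Suc.IH[OF xp]) (use Suc.prems a in \<open>auto split: if_splits\<close>)
    \<comment> \<open>For b = 0 the degree may be too small for the induction hypothesis with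
      exponent 2, but then the coefficient is 0.\<close>
    moreover have "Cn_unit_ball n (\<lambda>x. (- real b) * ((x $ i * p x) * truncated_cone (Suc a) (b + 2) x))"
    proof (cases "b = 0")
      case False
      have "Cn_unit_ball n (\<lambda>x. (x $ i * p x) * truncated_cone (Suc a) (b + 2) x)"
        by (rule Suc.IH[OF xp]) (use Suc.prems a False in \<open>auto split: if_splits\<close>)
      then show ?thesis
        by (rule Cn_unit_ball_cmult)
    qed (simp add: Cn_unit_ball_zero)
    ultimately show ?thesis
      unfolding G_def[abs_def] by (intro Cn_unit_ball_add Cn_unit_ball_cmult[of _ "\<lambda>x. (x $ i * p x) * truncated_cone a (b + 1) x"])
  qed
  moreover have "p x * truncated_cone a0 b x = 0" if "1 < norm x" for x
    using that a by (simp add: truncated_cone_def)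
  ultimately show ?case
    using partials by (intro Cn_unit_ball_SucI[where g = G]) auto
qed

text \<open>
  The recursion ends at \<open>(1 - r)\<^sub>+\<^sup>l\<close>, which \<open>wendland l 0\<close> is not: its prefactor \<open>1 / Gamma 0\<close> is \<open>0\<close>.
\<close>

definition wendland_radial :: "nat \<Rightarrow> nat \<Rightarrow> real^'n \<Rightarrow> real" where
  "wendland_radial l j x = (case j of 0 \<Rightarrow> truncated_cone l 0 x | Suc _ \<Rightarrow> wendland l j (norm x))"

lemma wendland_radial_has_partials:
  assumes "l \<ge> 1"
  shows "has_partials (wendland_radial l (Suc j)) (\<lambda>i x. - x $ i * wendland_radial l j x)"
proof -
  obtain q :: "nat \<Rightarrow> real \<Rightarrow> real" where q: "\<And>r. q 0 r = (1 - r) ^ l"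
    "\<And>j r. (q (Suc j) has_real_derivative - r * q j r) (at r)"
    "\<And>j. q (Suc j) 1 = 0"
    "\<And>j r. r \<le> 1 \<Longrightarrow> wendland l (Suc j) r = q (Suc j) r"
    using wendland_recursion[of l] by metis
  define \<rho> where "\<rho> j r = (if r \<le> 1 then q j r else 0)" for j r
  have radial: "wendland_radial l j x = \<rho> j (norm x)" for j and x :: "real^'n"
  proof (cases j)
    case 0
    with assms show ?thesis
      by (auto simp: wendland_radial_def \<rho>_def q(1) truncated_cone_def max_def)
  next
    case (Suc k)
    show ?thesis
      using q(4)[of "norm x" k] by (auto simp: Suc wendland_radial_def \<rho>_def wendland_def)
  qed
  have "(\<rho> (Suc j) has_real_derivative - r * \<rho> j r) (at r)" for r
  proof -
    \<comment> \<open>The cutoff requires the derivative to vanish at 1 as well; for j = 0 this is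
      0^l = 0 with l \<ge> 1.\<close>
    have "q j 1 = 0"
      using assms q(1,3) by (cases j) auto
    then have "(\<rho> (Suc j) has_real_derivative (if r \<le> 1 then - r * q j r else 0)) (at r)"
      unfolding \<rho>_def by (intro has_real_derivative_cutoff q) auto
    then show ?thesis
      by (cases "r \<le> 1") (simp_all add: \<rho>_def)
  qed
  then show ?thesis
    using radial_has_partials[of "\<rho> (Suc j)" "\<rho> j"] by (simp add: radial[abs_def])
qed

text \<open>
  Differentiation trades \<open>wendland_radial l j\<close> for \<open>wendland_radial l (j - 1)\<close> and a factor \<open>x\<^sub>i\<close>;
  the degree of the polynomial factor keeps track of the smoothness at the origin beyond the first
  \<open>j\<close> derivatives.
\<close>

lemma Cn_unit_ball_wendland_radial:
  fixes p :: "real^'n \<Rightarrow> real"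
  assumes "homogeneous_poly m p" "n \<le> m + 2 * j" "n + 1 \<le> l + j" "l \<ge> 1"
  shows "Cn_unit_ball n (\<lambda>x. p x * wendland_radial l j x)"
  using assms
proof (induction n arbitrary: m p j)
  case (0 m p j)
  show ?case
  proof (cases j)
    case 0
    show ?thesis
      using Cn_unit_ball_cone[OF \<open>homogeneous_poly m p\<close>, of 0 l 0] \<open>l \<ge> 1\<close>
      by (simp add: 0 wendland_radial_def)
  next
    case (Suc k)
    have "continuous_on UNIV p"
      using homogeneous_poly_partials[OF \<open>homogeneous_poly m p\<close>] has_partials_continuous by metis
    moreover have "continuous_on UNIV (wendland_radial l j :: real^'n \<Rightarrow> real)"
      using has_partials_continuous[OF wendland_radial_has_partials[OF \<open>l \<ge> 1\<close>]] Suc by metis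
    ultimately show ?thesis
      by (auto simp: Suc wendland_radial_def wendland_def intro!: continuous_on_mult)
  qed
next
  case (Suc n m p j)
  show ?case
  proof (cases j)
    case 0
    show ?thesis
      using Cn_unit_ball_cone[OF \<open>homogeneous_poly m p\<close>, of "Suc n" l 0] Suc.prems
      by (simp add: 0 wendland_radial_def)
  next
    case j: (Suc k)
    obtain g where g: "has_partials p g" "\<And>i. homogeneous_poly (m - 1) (g i)"
      using homogeneous_poly_partials[OF Suc.prems(1)] by metis
    define G where "G i x = g i x * wendland_radial l j x + (- 1) * ((x $ i * p x) * wendland_radial l k x)" for i x
    have "has_partials (\<lambda>x. p x * wendland_radial l j x) G"
      using has_partials_mult[OF g(1) wendland_radial_has_partials[OF \<open>l \<ge> 1\<close>, of k]]
      by (simp add: j G_def[abs_def] mult_ac)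
    \<comment> \<open>In the product rule either m falls by one, or m rises and j falls by one; both
      ways m + 2 j loses at most one.\<close>
    moreover have "Cn_unit_ball n (G i)" for i
      unfolding G_def
    proof (intro Cn_unit_ball_add Cn_unit_ball_cmult[of _ "\<lambda>x. (x $ i * p x) * wendland_radial l k x"])
      show "Cn_unit_ball n (\<lambda>x. g i x * wendland_radial l j x)"
        by (rule Suc.IH[OF g(2)]) (use Suc.prems in auto)
      show "Cn_unit_ball n (\<lambda>x. (x $ i * p x) * wendland_radial l k x)"
        by (rule Suc.IH[OF homogeneous_poly.component[OF Suc.prems(1)]]) (use Suc.prems j in auto)
    qed
    moreover have "p x * wendland_radial l j x = 0" if "1 < norm x" for x
      using that by (simp add: j wendland_radial_def wendland_def)
    ultimately show ?thesis
      by (intro Cn_unit_ball_SucI[where g = G]) auto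
  qed
qed

text \<open>The two bounds on n belong to different places: n \<le> 2 k to the origin, and n + 1
  \<le> l + k to the unit sphere, where the profile vanishes like (1 - r)^(l+k).\<close>

lemma Cn_unit_ball_wendland:
  assumes "k \<ge> 1" "n \<le> 2 * k" "n + 1 \<le> l + k" "l \<ge> 1"
  shows "Cn_unit_ball n (\<lambda>x::real^'n. wendland l k (norm x))"
proof -
  have "(\<lambda>x::real^'n. (1::real) * wendland_radial l k x) = (\<lambda>x. wendland l k (norm x))"
    using assms(1) by (cases k) (auto simp: wendland_radial_def)
  moreover have "Cn_unit_ball n (\<lambda>x::real^'n. (1::real) * wendland_radial l k x)"
    by (rule Cn_unit_ball_wendland_radial[OF homogeneous_poly.const]) (use assms in auto)
  ultimately show ?thesis
    by (simp only:)
qed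

text \<open>Two steps of the recursion give x_i x_j psi_{l,k-2} - delta_ij psi_{l,k-1}, which is
  visibly symmetric; for k = 2, psi_{l,0} is the truncated power.\<close>

lemma wendland_partial_deriv_commute:
  assumes "k \<ge> 2" "l \<ge> 1"
  shows "partial_deriv i (partial_deriv j (\<lambda>x::real^'n. wendland l k (norm x)))
       = partial_deriv j (partial_deriv i (\<lambda>x. wendland l k (norm x)))"
proof -
  obtain k' where k: "k = Suc (Suc k')"
    using assms(1) by (metis add_2_eq_Suc le_Suc_ex)
  have *: "(\<lambda>x::real^'n. wendland l k (norm x)) = wendland_radial l (Suc (Suc k'))"
    by (auto simp: k wendland_radial_def)
  have first: "partial_deriv i (wendland_radial l (Suc (Suc k'))) = (\<lambda>x::real^'n. (- 1 * x $ i) * wendland_radial l (Suc k') x)" for i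
    using has_partials_imp_partial_deriv[OF wendland_radial_has_partials[OF assms(2)]] by simp
  have "partial_deriv i (\<lambda>x::real^'n. (- 1 * x $ j) * wendland_radial l (Suc k') x) =
      (\<lambda>x. (0 * x $ j + - 1 * (if i = j then 1 else 0)) * wendland_radial l (Suc k') x
         + (- 1 * x $ j) * (- x $ i * wendland_radial l k' x))" for i j
    by (intro has_partials_imp_partial_deriv has_partials_mult has_partials_const has_partials_component
        wendland_radial_has_partials assms(2))
  then show ?thesis
    unfolding * first by (auto simp: fun_eq_iff)
qed

section \<open>Spectra of symmetric real matrices\<close>

lemma eigenvector_component:
  assumes "A \<in> carrier_mat n n" "eigenvector A v z" "i < n"
  shows "(\<Sum>j<n. A $$ (i, j) * vec_index v j) = z * vec_index v i"
proof -
  have v: "v \<in> carrier_vec n" "A *\<^sub>v v = z \<cdot>\<^sub>v v"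
    using assms(1,2) by (auto simp: eigenvector_def)
  have "vec_index (A *\<^sub>v v) i = (\<Sum>j<n. A $$ (i, j) * vec_index v j)"
    using assms(1,3) v(1) by (simp add: scalar_prod_def atLeast0LessThan)
  then show ?thesis
    using v assms(3) by simp
qed

lemma eigenvector_nonzero_component:
  assumes "A \<in> carrier_mat n n" "eigenvector A v z"
  obtains i where "i < n" "vec_index v i \<noteq> 0"
proof -
  have "v \<in> carrier_vec n" "v \<noteq> 0\<^sub>v n"
    using assms by (auto simp: eigenvector_def)
  then have "\<exists>i<n. vec_index v i \<noteq> 0"
    by (metis carrier_vecD eq_vecI index_zero_vec)
  with that show ?thesis
    by auto
qed

text \<open>Over the complex numbers an eigenvalue z with eigenvector w exists. The form w* A w is
  real by symmetry and equals z |w|^2, so z is real.\<close>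

lemma symmetric_mat_spectrum_nonempty:
  fixes A :: "real mat"
  assumes A: "A \<in> carrier_mat n n" and "n > 0"
    and sym: "\<And>i j. i < n \<Longrightarrow> j < n \<Longrightarrow> A $$ (i, j) = A $$ (j, i)"
  shows "spectrum A \<noteq> {}"
proof -
  define B where "B = map_mat complex_of_real A"
  have B: "B \<in> carrier_mat n n"
    using A by (simp add: B_def)
  obtain z v where v: "eigenvector B v z"
    using spectrum_non_empty[OF B \<open>n > 0\<close>] by (auto simp: spectrum_def eigenvalue_def)
  define w where "w i = vec_index v i" for i
  have comp: "(\<Sum>j<n. of_real (A $$ (i, j)) * w j) = z * w i" if "i < n" for i
    using eigenvector_component[OF B v that] A that by (simp add: B_def w_def)
  define Q where "Q = (\<Sum>i<n. cnj (w i) * (\<Sum>j<n. of_real (A $$ (i, j)) * w j))"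
  define R where "R = (\<Sum>i<n. (cmod (w i))\<^sup>2)"
  have "Q = (\<Sum>i<n. z * of_real ((cmod (w i))\<^sup>2))"
    unfolding Q_def complex_norm_square
    by (intro sum.cong refl, subst comp) (simp_all only: lessThan_iff mult_ac)
  then have Q: "Q = z * of_real R"
    by (simp add: R_def sum_distrib_left)
  have "cnj Q = (\<Sum>i<n. \<Sum>j<n. w i * of_real (A $$ (i, j)) * cnj (w j))"
    by (simp add: Q_def sum_distrib_left mult_ac)
  also have "\<dots> = (\<Sum>j<n. \<Sum>i<n. w i * of_real (A $$ (i, j)) * cnj (w j))"
    by (rule sum.swap)
  also have "\<dots> = Q"
    unfolding Q_def sum_distrib_left
    by (intro sum.cong refl) (use sym in \<open>simp add: mult_ac\<close>)
  finally have "cnj z * of_real R = z * of_real R"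
    by (simp add: Q)
  moreover obtain i where "i < n" "w i \<noteq> 0"
    using eigenvector_nonzero_component[OF B v] by (metis w_def)
  then have "R > 0"
    unfolding R_def by (intro sum_pos2[of _ i]) auto
  ultimately have "cnj z = z"
    by simp
  then obtain x where z: "z = of_real x"
    by (metis Reals_cases complex_is_Real_iff cnj.sel(2) eq_neg_iff_add_eq_0 double_zero)
  \<comment> \<open>The eigenvector found may still be complex; the characteristic polynomial
    carries the real eigenvalue over to \<open>A\<close>.\<close>
  have "poly (char_poly B) z = 0"
    using v eigenvalue_root_char_poly[OF B] by (auto simp: eigenvalue_def)
  then have "poly (char_poly A) x = 0"
    by (simp add: z B_def of_real_hom.char_poly_hom[OF A])
  then have "eigenvalue A x"
    using eigenvalue_root_char_poly[OF A] by simp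
  then show ?thesis
    by (auto simp: spectrum_def)
qed

text \<open>The eigenvalue equation is read in a component where the eigenvector has largest
  modulus.\<close>

lemma eigenvalue_le_entry_bound:
  fixes A :: "real mat"
  assumes A: "A \<in> carrier_mat n n" and "eigenvalue A z"
    and b: "\<And>i j. i < n \<Longrightarrow> j < n \<Longrightarrow> \<bar>A $$ (i, j)\<bar> \<le> b"
  shows "z \<le> real n * b"
proof -
  obtain v where v: "eigenvector A v z"
    using assms(2) by (auto simp: eigenvalue_def)
  define w where "w i = vec_index v i" for i
  obtain k where k: "k < n" "w k \<noteq> 0"
    using eigenvector_nonzero_component[OF A v] by (metis w_def)
  obtain i where i: "i < n" "\<And>j. j < n \<Longrightarrow> \<bar>w j\<bar> \<le> \<bar>w i\<bar>"
  proof -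
    have "Max ((\<lambda>j. \<bar>w j\<bar>) ` {..<n}) \<in> (\<lambda>j. \<bar>w j\<bar>) ` {..<n}"
      using k by (intro Max_in) auto
    then obtain i where "i < n" "\<bar>w i\<bar> = Max ((\<lambda>j. \<bar>w j\<bar>) ` {..<n})"
      by auto
    then show ?thesis
      by (intro that[of i]) auto
  qed
  have "z * w i = (\<Sum>j<n. A $$ (i, j) * w j)"
    using eigenvector_component[OF A v i(1)] by (simp add: w_def)
  then have "\<bar>z\<bar> * \<bar>w i\<bar> \<le> (\<Sum>j<n. \<bar>A $$ (i, j)\<bar> * \<bar>w j\<bar>)"
    using sum_abs[of "\<lambda>j. A $$ (i, j) * w j" "{..<n}"] by (simp only: abs_mult[symmetric])
  also have "\<dots> \<le> (\<Sum>j<n. b * \<bar>w i\<bar>)"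
  proof (intro sum_mono mult_mono)
    show "0 \<le> b"
      using b[OF i(1) i(1)] by simp
  qed (use b i in auto)
  finally have "\<bar>z\<bar> * \<bar>w i\<bar> \<le> (real n * b) * \<bar>w i\<bar>"
    by simp
  moreover have "\<bar>w i\<bar> > 0"
    using i(2)[OF k(1)] k(2) by simp
  ultimately have "\<bar>z\<bar> \<le> real n * b"
    by simp
  then show ?thesis
    by simp
qed

lemma lambda_max_le_entry_bound:
  assumes "A \<in> carrier_mat n n" "n > 0"
    and "\<And>i j. i < n \<Longrightarrow> j < n \<Longrightarrow> A $$ (i, j) = A $$ (j, i)"
    and "\<And>i j. i < n \<Longrightarrow> j < n \<Longrightarrow> \<bar>A $$ (i, j)\<bar> \<le> b"
  shows "lambda_max A \<le> real n * b"
proof -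
  have "lambda_max A \<in> spectrum A"
    unfolding lambda_max_def
    by (rule Max_in[OF card_finite_spectrum(1)[OF assms(1)] symmetric_mat_spectrum_nonempty[OF assms(1-3)]])
  then show ?thesis
    using eigenvalue_le_entry_bound[OF assms(1) _ assms(4)] by (simp add: spectrum_def)
qed

section \<open>Entries of the collocation matrix\<close>

text \<open>One rule for three purposes: s = 1 / \<delta> for scaling, s = - 1 / \<delta> for
  derivatives in y of a function of x - y, and s = -1 for parity.\<close>

lemma partial_deriv_affine:
  fixes f :: "real^'n \<Rightarrow> real"
  assumes "Cn_unit_ball (Suc n) f"
  shows "partial_deriv i (\<lambda>x. c * f (s *\<^sub>R x + b)) = (\<lambda>x. c * s * partial_deriv i f (s *\<^sub>R x + b))"
proof (rule has_partials_imp_partial_deriv[where g = "\<lambda>i x. c * s * partial_deriv i f (s *\<^sub>R x + b)"])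
  have f: "has_partials f (\<lambda>i. partial_deriv i f)"
    by (rule Cn_unit_ball_has_partials[OF assms])
  show "has_partials (\<lambda>x. c * f (s *\<^sub>R x + b)) (\<lambda>i x. c * s * partial_deriv i f (s *\<^sub>R x + b))"
    unfolding has_partials_def
  proof
    fix x :: "real^'n"
    have "((\<lambda>x. s *\<^sub>R x + b) has_derivative (\<lambda>h. s *\<^sub>R h)) (at x)"
      by (auto intro!: derivative_eq_intros)
    moreover have "(f has_derivative (\<lambda>h. \<Sum>i\<in>UNIV. h $ i * partial_deriv i f (s *\<^sub>R x + b))) (at (s *\<^sub>R x + b))"
      using f by (simp add: has_partials_def)
    ultimately have "((\<lambda>x. f (s *\<^sub>R x + b)) has_derivative
        (\<lambda>h. \<Sum>i\<in>UNIV. (s *\<^sub>R h) $ i * partial_deriv i f (s *\<^sub>R x + b))) (at x)"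
      by (rule has_derivative_compose)
    then have "((\<lambda>x. c * f (s *\<^sub>R x + b)) has_derivative
        (\<lambda>h. c * (\<Sum>i\<in>UNIV. (s *\<^sub>R h) $ i * partial_deriv i f (s *\<^sub>R x + b)))) (at x)"
      by (rule has_derivative_mult_right)
    then show "((\<lambda>x. c * f (s *\<^sub>R x + b)) has_derivative
        (\<lambda>h. \<Sum>i\<in>UNIV. h $ i * (c * s * partial_deriv i f (s *\<^sub>R x + b)))) (at x)"
      by (simp add: sum_distrib_left mult_ac)
  qed
qed

lemma partial_deriv2_affine:
  assumes "Cn_unit_ball (Suc (Suc n)) f"
  shows "partial_deriv i (partial_deriv j (\<lambda>x. c * f (s *\<^sub>R x + b)))
       = (\<lambda>x. c * s\<^sup>2 * partial_deriv i (partial_deriv j f) (s *\<^sub>R x + b))"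
  unfolding partial_deriv_affine[OF assms] partial_deriv_affine[OF Cn_unit_ball_partial_deriv[OF assms]]
  by (simp add: power2_eq_square mult_ac)

lemma laplacian_affine:
  assumes "Cn_unit_ball (Suc (Suc n)) f"
  shows "laplacian (\<lambda>x. c * f (s *\<^sub>R x + b)) x = c * s\<^sup>2 * laplacian f (s *\<^sub>R x + b)"
  unfolding laplacian_def partial_deriv2_affine[OF assms] by (rule sum_distrib_left[symmetric])

lemma divfree_kernel_affine:
  assumes "Cn_unit_ball (Suc (Suc n)) f"
  shows "divfree_kernel (\<lambda>x. c * f (s *\<^sub>R x + b)) x $ i $ j = c * s\<^sup>2 * divfree_kernel f (s *\<^sub>R x + b) $ i $ j"
  unfolding divfree_kernel_def laplacian_affine[OF assms] partial_deriv2_affine[OF assms]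
  by (simp add: algebra_simps)

text \<open>Reflection is the affine map with s = -1, and two derivatives produce s^2 = 1.\<close>

lemma partial_deriv2_even:
  assumes "Cn_unit_ball (Suc (Suc n)) f" "\<And>x. f (- x) = f x"
  shows "partial_deriv i (partial_deriv j f) (- x) = partial_deriv i (partial_deriv j f) x"
  using fun_cong[OF partial_deriv2_affine[OF assms(1), of i j 1 "-1" 0], of x] assms(2) by simp

lemma laplacian_even:
  assumes "Cn_unit_ball (Suc (Suc n)) f" "\<And>x. f (- x) = f x"
  shows "laplacian f (- x) = laplacian f x"
  using laplacian_affine[OF assms(1), of 1 "-1" 0 x] assms(2) by simp

lemma divfree_kernel_even:
  assumes "Cn_unit_ball (Suc (Suc n)) f" "\<And>x. f (- x) = f x"
  shows "divfree_kernel f (- x) $ i $ j = divfree_kernel f x $ i $ j"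
  using divfree_kernel_affine[OF assms(1), of 1 "-1" 0 x i j] assms(2) by simp

lemma Cn_unit_ball_divfree_kernel:
  assumes "Cn_unit_ball (Suc (Suc n)) f"
  shows "Cn_unit_ball n (\<lambda>x. divfree_kernel f x $ i $ j)"
proof -
  have "Cn_unit_ball n (\<lambda>x. (if i = j then - 1 else 0) * laplacian f x + partial_deriv i (partial_deriv j f) x)"
  proof (rule Cn_unit_ball_add)
    show "Cn_unit_ball n (\<lambda>x. (if i = j then - 1 else 0) * laplacian f x)"
      by (rule Cn_unit_ball_cmult[OF Cn_unit_ball_laplacian[OF assms]])
    show "Cn_unit_ball n (partial_deriv i (partial_deriv j f))"
      by (rule Cn_unit_ball_partial_deriv[OF Cn_unit_ball_partial_deriv[OF assms]])
  qed
  moreover have "(if i = j then - 1 else 0) * laplacian f x + partial_deriv i (partial_deriv j f) x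
      = divfree_kernel f x $ i $ j" for x
    by (simp add: divfree_kernel_def)
  ultimately show ?thesis
    by (simp only:)
qed

section \<open>The unscaled kernels\<close>

definition wendland_kernel :: "nat \<Rightarrow> real^'n \<Rightarrow> real" where
  "wendland_kernel k x = wendland (CARD('n) div 2 + k + 1) k (norm x)"

text \<open>With this l the condition at the sphere, n + 1 \<le> l + k, follows from n \<le> 2
  k.\<close>

lemma Cn_unit_ball_wendland_kernel:
  assumes "k \<ge> 1" "n \<le> 2 * k"
  shows "Cn_unit_ball n (wendland_kernel k)"
  unfolding wendland_kernel_def[abs_def] by (rule Cn_unit_ball_wendland) (use assms in auto)

lemma wendland_kernel_even: "wendland_kernel k (- x) = wendland_kernel k x"
  by (simp add: wendland_kernel_def)

lemma wendland_kernel_partial_deriv_commute: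
  assumes "k \<ge> 2"
  shows "partial_deriv i (partial_deriv j (wendland_kernel k)) = partial_deriv j (partial_deriv i (wendland_kernel k))"
  unfolding wendland_kernel_def[abs_def] by (rule wendland_partial_deriv_commute) (use assms in auto)

definition velocity_kernel :: "nat \<Rightarrow> 'n \<Rightarrow> 'n \<Rightarrow> real^'n \<Rightarrow> real" where
  "velocity_kernel k i j x = divfree_kernel (wendland_kernel (k + 2)) x $ i $ j"

text \<open>The parameter k + 2 \<ge> 3 supplies six derivatives; two are spent on the
  divergence-free operator, and four remain for a Laplacian in x and one in y.\<close>

lemma Cn_unit_ball_velocity_kernel:
  assumes "k \<ge> 1"
  shows "Cn_unit_ball 4 (velocity_kernel k i j)"
  unfolding velocity_kernel_def[abs_def]
  by (intro Cn_unit_ball_divfree_kernel Cn_unit_ball_wendland_kernel) (use assms in auto)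

lemma velocity_kernel_even: "k \<ge> 1 \<Longrightarrow> velocity_kernel k i j (- x) = velocity_kernel k i j x"
  unfolding velocity_kernel_def
  by (rule divfree_kernel_even[OF Cn_unit_ball_wendland_kernel[where n = "Suc (Suc 0)"]])
     (auto simp: wendland_kernel_even)

lemma velocity_kernel_symmetric: "k \<ge> 1 \<Longrightarrow> velocity_kernel k i j = velocity_kernel k j i"
  unfolding velocity_kernel_def[abs_def] divfree_kernel_def
  using wendland_kernel_partial_deriv_commute[of "k + 2" i j] by auto

lemma scaled_wendland_eq:
  assumes "\<delta> > 0"
  shows "scaled_wendland k \<delta> = (\<lambda>x::real^'n. (1 / \<delta>) ^ CARD('n) * wendland_kernel k ((1 / \<delta>) *\<^sub>R x + 0))"
  using assms by (simp add: fun_eq_iff scaled_wendland_def wendland_kernel_def power_int_minus power_one_over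
      inverse_eq_divide)

lemma stokes_kernel_velocity:
  fixes x :: "real^'n"
  assumes "\<delta> > 0" "k \<ge> 1"
  shows "stokes_kernel k \<delta> x $ Some i $ Some j = (1 / \<delta>) ^ (CARD('n) + 2) * velocity_kernel k i j ((1 / \<delta>) *\<^sub>R x)"
proof -
  have "divfree_kernel (scaled_wendland (k + 2) \<delta>) x $ i $ j
     = (1 / \<delta>) ^ CARD('n) * (1 / \<delta>)\<^sup>2 * divfree_kernel (wendland_kernel (k + 2)) ((1 / \<delta>) *\<^sub>R x + 0) $ i $ j"
    unfolding scaled_wendland_eq[OF assms(1)]
    by (rule divfree_kernel_affine[OF Cn_unit_ball_wendland_kernel[where n = "Suc (Suc 0)"]]) auto
  then show ?thesis
    by (simp add: stokes_kernel_def velocity_kernel_def power_add power2_eq_square)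
qed

lemma stokes_kernel_pressure:
  fixes x :: "real^'n"
  assumes "\<delta> > 0"
  shows "stokes_kernel k \<delta> x $ None $ None = (1 / \<delta>) ^ CARD('n) * wendland_kernel k ((1 / \<delta>) *\<^sub>R x)"
  using assms by (simp add: stokes_kernel_def scaled_wendland_eq)

lemma stokes_kernel_mixed:
  "stokes_kernel k \<delta> x $ Some i $ None = 0" "stokes_kernel k \<delta> x $ None $ Some i = 0"
  by (simp_all add: stokes_kernel_def)

section \<open>The collocation functionals applied to the kernel\<close>

lemma stokes_op_eq:
  "stokes_op \<nu> v x $ i = - \<nu> * laplacian (\<lambda>y. v y $ Some i) x + partial_deriv i (\<lambda>y. v y $ None) x"
  by (simp add: stokes_op_def laplacian_def)

lemma partial_deriv_const: "partial_deriv i (\<lambda>x. c) = (\<lambda>x. 0)"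
  using has_partials_imp_partial_deriv[OF has_partials_const] .

lemma laplacian_const: "laplacian (\<lambda>x. c) x = 0"
  by (simp add: laplacian_def partial_deriv_const)

text \<open>The Laplacian in y brings out (- 1 / \<delta>)^2, hence no change of sign. The argument
  is displayed as an affine function of x, ready for the outer functional.\<close>

lemma inner_colloc_velocity:
  fixes x :: "real^'n" and X :: "nat \<Rightarrow> real^'n"
  assumes "\<delta> > 0" "k \<ge> 1"
  shows "colloc_functional \<nu> N X i j (\<lambda>y. stokes_kernel k \<delta> (x - y) $ Some a) =
    (if j \<le> N then - \<nu> * (1 / \<delta>) ^ (CARD('n) + 4) * laplacian (velocity_kernel k a i) ((1 / \<delta>) *\<^sub>R x + - ((1 / \<delta>) *\<^sub>R X j))
     else (1 / \<delta>) ^ (CARD('n) + 2) * velocity_kernel k a i ((1 / \<delta>) *\<^sub>R x + - ((1 / \<delta>) *\<^sub>R X j)))"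
proof -
  have scale: "(1 / \<delta>) *\<^sub>R (x - y) = (- (1 / \<delta>)) *\<^sub>R y + (1 / \<delta>) *\<^sub>R x" for y
    by (simp add: scaleR_diff_right)
  have "laplacian (\<lambda>y. stokes_kernel k \<delta> (x - y) $ Some a $ Some i) (X j) =
     laplacian (\<lambda>y. (1 / \<delta>) ^ (CARD('n) + 2) * velocity_kernel k a i ((- (1 / \<delta>)) *\<^sub>R y + (1 / \<delta>) *\<^sub>R x)) (X j)"
    unfolding stokes_kernel_velocity[OF assms] scale ..
  also have "\<dots> = (1 / \<delta>) ^ (CARD('n) + 2) * (- (1 / \<delta>))\<^sup>2 *
      laplacian (velocity_kernel k a i) ((- (1 / \<delta>)) *\<^sub>R X j + (1 / \<delta>) *\<^sub>R x)"
    by (rule laplacian_affine[where n = 2]) (use Cn_unit_ball_velocity_kernel[OF assms(2), of a i] in \<open>simp add: numeral_eq_Suc\<close>)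
  finally have "laplacian (\<lambda>y. stokes_kernel k \<delta> (x - y) $ Some a $ Some i) (X j) =
     (1 / \<delta>) ^ (CARD('n) + 4) * laplacian (velocity_kernel k a i) ((1 / \<delta>) *\<^sub>R x + - ((1 / \<delta>) *\<^sub>R X j))"
    by (simp add: power_add power2_eq_square power4_eq_xxxx)
  then show ?thesis
    by (simp add: colloc_functional_def stokes_op_eq stokes_kernel_mixed partial_deriv_const
        stokes_kernel_velocity[OF assms] scaleR_diff_right)
qed

lemma inner_colloc_pressure:
  fixes x :: "real^'n" and X :: "nat \<Rightarrow> real^'n"
  assumes "\<delta> > 0" "k \<ge> 1"
  shows "colloc_functional \<nu> N X i j (\<lambda>y. stokes_kernel k \<delta> (x - y) $ None) =
    (if j \<le> N then - ((1 / \<delta>) ^ (CARD('n) + 1)) * partial_deriv i (wendland_kernel k) ((1 / \<delta>) *\<^sub>R x + - ((1 / \<delta>) *\<^sub>R X j))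
     else 0)"
proof -
  have scale: "(1 / \<delta>) *\<^sub>R (x - y) = (- (1 / \<delta>)) *\<^sub>R y + (1 / \<delta>) *\<^sub>R x" for y
    by (simp add: scaleR_diff_right)
  have "partial_deriv i (\<lambda>y. stokes_kernel k \<delta> (x - y) $ None $ None) =
     partial_deriv i (\<lambda>y. (1 / \<delta>) ^ CARD('n) * wendland_kernel k ((- (1 / \<delta>)) *\<^sub>R y + (1 / \<delta>) *\<^sub>R x))"
    unfolding stokes_kernel_pressure[OF assms(1)] scale ..
  also have "\<dots> = (\<lambda>y. (1 / \<delta>) ^ CARD('n) * (- (1 / \<delta>)) *
      partial_deriv i (wendland_kernel k) ((- (1 / \<delta>)) *\<^sub>R y + (1 / \<delta>) *\<^sub>R x))"
    by (rule partial_deriv_affine[OF Cn_unit_ball_wendland_kernel[where n = "Suc 0"]]) (use assms in auto)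
  finally have "partial_deriv i (\<lambda>y. stokes_kernel k \<delta> (x - y) $ None $ None) (X j) =
     - ((1 / \<delta>) ^ (CARD('n) + 1)) * partial_deriv i (wendland_kernel k) ((1 / \<delta>) *\<^sub>R x + - ((1 / \<delta>) *\<^sub>R X j))"
    by simp
  then show ?thesis
    by (simp add: colloc_functional_def stokes_op_eq stokes_kernel_mixed laplacian_const)
qed

text \<open>The exponents count derivatives: d from the scaling, 2 from the divergence-free
  operator, 2 for each Laplacian. The pressure term has one first derivative in each variable; the
  one in y causes its minus sign.\<close>

lemma colloc_entry_eq:
  fixes X :: "nat \<Rightarrow> real^'n" and p q :: "'n \<times> nat"
  assumes "\<delta> > 0" "k \<ge> 1"
  defines "s \<equiv> 1 / \<delta>" and "z \<equiv> (1 / \<delta>) *\<^sub>R (X (snd p) - X (snd q))"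
  shows "colloc_entry k \<nu> \<delta> N X p q =
    (if snd p \<le> N then
       if snd q \<le> N then
         \<nu>\<^sup>2 * s ^ (CARD('n) + 6) * laplacian (laplacian (velocity_kernel k (fst p) (fst q))) z
         - s ^ (CARD('n) + 2) * partial_deriv (fst p) (partial_deriv (fst q) (wendland_kernel k)) z
       else - \<nu> * s ^ (CARD('n) + 4) * laplacian (velocity_kernel k (fst p) (fst q)) z
     else
       if snd q \<le> N then - \<nu> * s ^ (CARD('n) + 4) * laplacian (velocity_kernel k (fst p) (fst q)) z
       else s ^ (CARD('n) + 2) * velocity_kernel k (fst p) (fst q) z)"
proof -
  let ?K = "velocity_kernel k (fst p) (fst q)" and ?b = "- (s *\<^sub>R X (snd q))"
  have z: "s *\<^sub>R X (snd p) + ?b = z"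
    by (simp add: z_def s_def scaleR_diff_right)
  have K: "Cn_unit_ball (Suc (Suc 2)) ?K"
    using Cn_unit_ball_velocity_kernel[OF assms(2), of "fst p" "fst q"] by (simp add: numeral_eq_Suc)
  have LK: "Cn_unit_ball (Suc (Suc 0)) (laplacian ?K)"
    using Cn_unit_ball_laplacian[OF K] by (simp add: numeral_eq_Suc)
  have DV: "Cn_unit_ball (Suc 0) (partial_deriv (fst q) (wendland_kernel k :: real^'n \<Rightarrow> real))"
    by (intro Cn_unit_ball_partial_deriv Cn_unit_ball_wendland_kernel) (use assms in auto)
  note velocity = inner_colloc_velocity[OF assms(1,2), folded s_def]
  note pressure = inner_colloc_pressure[OF assms(1,2), folded s_def]
  show ?thesis
  proof (cases "snd p \<le> N"; cases "snd q \<le> N")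
    assume pq: "snd p \<le> N" "snd q \<le> N"
    have "colloc_entry k \<nu> \<delta> N X p q =
       - \<nu> * laplacian (\<lambda>x. (- \<nu> * s ^ (CARD('n) + 4)) * laplacian ?K (s *\<^sub>R x + ?b)) (X (snd p))
       + partial_deriv (fst p) (\<lambda>x. - (s ^ (CARD('n) + 1)) * partial_deriv (fst q) (wendland_kernel k) (s *\<^sub>R x + ?b)) (X (snd p))"
      using pq by (simp add: colloc_entry_def colloc_functional_def[of \<nu> N X "fst p"] stokes_op_eq velocity pressure
          del: power_Suc)
    also have "\<dots> = - \<nu> * ((- \<nu> * s ^ (CARD('n) + 4)) * s\<^sup>2 * laplacian (laplacian ?K) z)
       + (- (s ^ (CARD('n) + 1)) * s * partial_deriv (fst p) (partial_deriv (fst q) (wendland_kernel k)) z)"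
      unfolding laplacian_affine[OF LK] partial_deriv_affine[OF DV] z ..
    finally show ?thesis
      using pq by (simp add: power_add power2_eq_square numeral_eq_Suc)
  next
    assume pq: "snd p \<le> N" "\<not> snd q \<le> N"
    have "colloc_entry k \<nu> \<delta> N X p q =
       - \<nu> * laplacian (\<lambda>x. s ^ (CARD('n) + 2) * ?K (s *\<^sub>R x + ?b)) (X (snd p))"
      using pq by (simp add: colloc_entry_def colloc_functional_def[of \<nu> N X "fst p"] stokes_op_eq velocity pressure
          partial_deriv_const del: power_Suc)
    also have "\<dots> = - \<nu> * (s ^ (CARD('n) + 2) * s\<^sup>2 * laplacian ?K z)"
      unfolding laplacian_affine[OF K] z ..
    finally show ?thesis
      using pq by (simp add: power_add power2_eq_square numeral_eq_Suc)
  next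
    assume pq: "\<not> snd p \<le> N" "snd q \<le> N"
    then show ?thesis
      by (simp add: colloc_entry_def colloc_functional_def[of \<nu> N X "fst p"] velocity z[simplified])
  next
    assume pq: "\<not> snd p \<le> N" "\<not> snd q \<le> N"
    then show ?thesis
      by (simp add: colloc_entry_def colloc_functional_def[of \<nu> N X "fst p"] velocity z[simplified])
  qed
qed

text \<open>Exchanging p and q reflects z and swaps the component indices. The kernels are even,
  only derivatives of even order occur, and the index swap is absorbed by commuting second
  derivatives.\<close>

lemma colloc_entry_symmetric:
  fixes X :: "nat \<Rightarrow> real^'n" and p q :: "'n \<times> nat"
  assumes "\<delta> > 0" "k \<ge> 2"
  shows "colloc_entry k \<nu> \<delta> N X p q = colloc_entry k \<nu> \<delta> N X q p"
proof -
  have k: "k \<ge> 1"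
    using assms by simp
  let ?K = "velocity_kernel k (fst p) (fst q)"
  have sym: "velocity_kernel k (fst q) (fst p) = ?K"
    by (rule velocity_kernel_symmetric[OF k])
  have K: "Cn_unit_ball (Suc (Suc 2)) ?K"
    using Cn_unit_ball_velocity_kernel[OF k, of "fst p" "fst q"] by (simp add: numeral_eq_Suc)
  have LK: "Cn_unit_ball (Suc (Suc 0)) (laplacian ?K)"
    using Cn_unit_ball_laplacian[OF K] by (simp add: numeral_eq_Suc)
  have V: "Cn_unit_ball (Suc (Suc 0)) (wendland_kernel k :: real^'n \<Rightarrow> real)"
    by (rule Cn_unit_ball_wendland_kernel) (use assms in auto)
  have even: "?K (- z) = ?K z" "laplacian ?K (- z) = laplacian ?K z"
    "laplacian (laplacian ?K) (- z) = laplacian (laplacian ?K) z"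
    "partial_deriv (fst p) (partial_deriv (fst q) (wendland_kernel k)) (- z)
       = partial_deriv (fst q) (partial_deriv (fst p) (wendland_kernel k)) z" for z
    by (simp_all add: velocity_kernel_even[OF k] laplacian_even[OF K] laplacian_even[OF LK]
        partial_deriv2_even[OF V] wendland_kernel_even
        wendland_kernel_partial_deriv_commute[OF assms(2), of "fst p" "fst q"])
  have neg: "(1 / \<delta>) *\<^sub>R (X (snd p) - X (snd q)) = - ((1 / \<delta>) *\<^sub>R (X (snd q) - X (snd p)))"
    by (simp add: scaleR_diff_right)
  show ?thesis
    unfolding colloc_entry_eq[OF assms(1) k] sym neg even
    by (cases "snd p \<le> N"; cases "snd q \<le> N") (simp_all only: if_True if_False)
qed

section \<open>The eigenvalue bound\<close>

lemma Cn_unit_ball_uniformly_bounded: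
  fixes f :: "'i::finite \<Rightarrow> real^'n \<Rightarrow> real"
  assumes "\<And>i. Cn_unit_ball n (f i)"
  obtains B where "\<And>i x. \<bar>f i x\<bar> \<le> B"
proof -
  have "\<exists>B. \<forall>x. \<bar>f i x\<bar> \<le> B" for i
    using Cn_unit_ball_bounded[OF assms[of i]] by metis
  then obtain B where B: "\<And>i x. \<bar>f i x\<bar> \<le> B i"
    by metis
  have "\<bar>f i x\<bar> \<le> Max (range B)" for i x
    by (rule order_trans[OF B[of i x]]) simp
  then show ?thesis
    by (rule that)
qed

text \<open>The common majorant m lets both ranges of \<delta> share one constant. E is built from
  suprema of unscaled functions over the whole space, hence it does not depend on \<delta> or on the
  centres.\<close>

lemma colloc_entry_bound:
  assumes "k \<ge> 2" "\<nu> > 0"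
  obtains E where "E \<ge> 0"
    "\<And>\<delta> N (X :: nat \<Rightarrow> real^'n) p q m. \<delta> > 0 \<Longrightarrow> (1 / \<delta>) ^ (CARD('n) + 2) \<le> m \<Longrightarrow> (1 / \<delta>) ^ (CARD('n) + 4) \<le> m \<Longrightarrow>
       (1 / \<delta>) ^ (CARD('n) + 6) \<le> m \<Longrightarrow> \<bar>colloc_entry k \<nu> \<delta> N X p q\<bar> \<le> E * m"
proof -
  have k: "k \<ge> 1"
    using assms by simp
  let ?K = "\<lambda>ij :: 'n \<times> 'n. velocity_kernel k (fst ij) (snd ij)"
  let ?T = "\<lambda>ij :: 'n \<times> 'n. partial_deriv (fst ij) (partial_deriv (snd ij) (wendland_kernel k))"
  have K: "Cn_unit_ball (Suc (Suc 2)) (?K ij)" for ij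
    using Cn_unit_ball_velocity_kernel[OF k] by (simp add: numeral_eq_Suc)
  have LK: "Cn_unit_ball (Suc (Suc 0)) (laplacian (?K ij))" for ij
    using Cn_unit_ball_laplacian[OF K] by (simp add: numeral_eq_Suc)
  have T: "Cn_unit_ball 0 (?T ij)" for ij
    by (intro Cn_unit_ball_partial_deriv Cn_unit_ball_wendland_kernel) (use assms in auto)
  obtain B0 where B0: "\<And>ij x. \<bar>?K ij x\<bar> \<le> B0"
    using Cn_unit_ball_uniformly_bounded[of _ ?K, OF K] by metis
  obtain B1 where B1: "\<And>ij x. \<bar>laplacian (?K ij) x\<bar> \<le> B1"
    using Cn_unit_ball_uniformly_bounded[of _ "\<lambda>ij. laplacian (?K ij)", OF LK] by metis
  obtain B2 where B2: "\<And>ij x. \<bar>laplacian (laplacian (?K ij)) x\<bar> \<le> B2"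
    using Cn_unit_ball_uniformly_bounded[of _ "\<lambda>ij. laplacian (laplacian (?K ij))", OF Cn_unit_ball_laplacian[OF LK]] by metis
  obtain B3 where B3: "\<And>ij x. \<bar>?T ij x\<bar> \<le> B3"
    using Cn_unit_ball_uniformly_bounded[of _ ?T, OF T] by metis
  have pos: "0 \<le> B0" "0 \<le> B1" "0 \<le> B2" "0 \<le> B3"
    using B0[of undefined 0] B1[of undefined 0] B2[of undefined 0] B3[of undefined 0] by linarith+
  \<comment> \<open>It dominates the bound of each block: B0 for boundary pairs, \<nu> B1 for mixed
    pairs, \<nu>^2 B2 + B3 for interior pairs.\<close>
  define E where "E = B0 + \<nu> * B1 + \<nu>\<^sup>2 * B2 + B3"
  have E: "B0 \<le> E" "\<nu> * B1 \<le> E" "\<nu>\<^sup>2 * B2 + B3 \<le> E"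
    using pos assms by (auto simp: E_def)
  have prod: "\<bar>c * t * u\<bar> \<le> (\<bar>c\<bar> * b) * m" if "0 \<le> t" "t \<le> m" "\<bar>u\<bar> \<le> b" for c t u b m :: real
  proof -
    have "t * \<bar>u\<bar> \<le> m * b"
      using that by (intro mult_mono) auto
    then have "\<bar>c\<bar> * (t * \<bar>u\<bar>) \<le> \<bar>c\<bar> * (m * b)"
      by (rule mult_left_mono) simp
    then show ?thesis
      using that(1) by (simp add: abs_mult mult_ac)
  qed
  show ?thesis
  proof (rule that[of E])
    show "E \<ge> 0"
      using E(1) pos(1) by linarith
    fix \<delta> :: real and N and X :: "nat \<Rightarrow> real^'n" and p q :: "'n \<times> nat" and m
    assume \<delta>: "\<delta> > 0" and m: "(1 / \<delta>) ^ (CARD('n) + 2) \<le> m" "(1 / \<delta>) ^ (CARD('n) + 4) \<le> m"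
       "(1 / \<delta>) ^ (CARD('n) + 6) \<le> m"
    define s where "s = 1 / \<delta>"
    note m = m[folded s_def]
    have s: "0 \<le> s ^ n" for n
      using \<delta> by (simp add: s_def)
    have "0 \<le> m"
      using s m(1) by (rule order_trans)
    then have E_mono: "e * m \<le> E * m" if "e \<le> E" for e
      using that by (intro mult_right_mono)
    define z where "z = s *\<^sub>R (X (snd p) - X (snd q))"
    have "\<bar>\<nu>\<^sup>2 * s ^ (CARD('n) + 6) * laplacian (laplacian (?K (fst p, fst q))) z\<bar> \<le> (\<bar>\<nu>\<^sup>2\<bar> * B2) * m"
      by (rule prod[OF s m(3) B2])
    moreover have "\<bar>1 * s ^ (CARD('n) + 2) * ?T (fst p, fst q) z\<bar> \<le> (\<bar>1\<bar> * B3) * m"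
      by (rule prod[OF s m(1) B3])
    moreover have "\<bar>u - v\<bar> \<le> E * m" if "\<bar>u\<bar> \<le> (\<bar>\<nu>\<^sup>2\<bar> * B2) * m" "\<bar>1 * v\<bar> \<le> (\<bar>1\<bar> * B3) * m" for u v
      using that E_mono[OF E(3)] by (simp add: distrib_right)
    ultimately have "\<bar>\<nu>\<^sup>2 * s ^ (CARD('n) + 6) * laplacian (laplacian (?K (fst p, fst q))) z
        - s ^ (CARD('n) + 2) * ?T (fst p, fst q) z\<bar> \<le> E * m"
      by (simp only: mult_1_left)
    moreover have "\<bar>- \<nu> * s ^ (CARD('n) + 4) * laplacian (?K (fst p, fst q)) z\<bar> \<le> E * m"
      using prod[OF s m(2) B1, of "- \<nu>" "(fst p, fst q)" z] E_mono[OF E(2)] assms(2) by simp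
    moreover have "\<bar>s ^ (CARD('n) + 2) * ?K (fst p, fst q) z\<bar> \<le> E * m"
      using prod[OF s m(1) B0, of 1 "(fst p, fst q)" z] E_mono[OF E(1)] by simp
    ultimately show "\<bar>colloc_entry k \<nu> \<delta> N X p q\<bar> \<le> E * m"
      unfolding colloc_entry_eq[OF \<delta> k, where X = X and p = p and q = q, folded s_def, folded z_def] fst_conv snd_conv
      by (cases "snd p \<le> N"; cases "snd q \<le> N") (simp_all only: if_True if_False)
  qed
qed

text \<open>A real supremum dominates its members only if the set is bounded above; the distance to
  one fixed t in T provides the bound.\<close>

lemma mesh_norm_nonneg:
  fixes S :: "'a::metric_space set"
  assumes "finite T" "T \<noteq> {}" "bounded S" "S \<noteq> {}"
  shows "0 \<le> mesh_norm T S"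
proof -
  obtain x where x: "x \<in> S"
    using assms by auto
  obtain t where t: "t \<in> T"
    using assms by auto
  obtain e where e: "\<And>y. y \<in> S \<Longrightarrow> dist t y \<le> e"
    using assms(3) bounded_any_center[of S t] by auto
  have "bdd_above ((\<lambda>x. Min ((\<lambda>t. dist x t) ` T)) ` S)"
  proof (rule bdd_aboveI2)
    fix y assume "y \<in> S"
    have "Min ((\<lambda>t. dist y t) ` T) \<le> dist y t"
      using assms t by (intro Min_le) auto
    also have "\<dots> \<le> e"
      using e[OF \<open>y \<in> S\<close>] by (simp add: dist_commute)
    finally show "Min ((\<lambda>t. dist y t) ` T) \<le> e" .
  qed
  then have "Min ((\<lambda>t. dist x t) ` T) \<le> mesh_norm T S"
    unfolding mesh_norm_def using x by (rule cSUP_upper2) simp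
  moreover have "0 \<le> Min ((\<lambda>t. dist x t) ` T)"
    using assms by (intro Min.boundedI) auto
  ultimately show ?thesis
    by linarith
qed

theorem theorem5p6:
  fixes \<Omega> :: "(real^'n) set"
    and \<phi> :: "nat \<Rightarrow> real^'m \<Rightarrow> real^'n"
    and J k :: nat
    and \<nu> C0 :: real
  assumes "CARD('n) \<ge> 2"
    and "CARD('n) = CARD('m) + 1"
    and "bounded_smooth_domain \<Omega>"
    and "boundary_atlas \<Omega> J \<phi>"
    and "\<nu> > 0"
    and "k \<ge> 2"
  shows "\<exists>C>0. \<forall>(\<delta>::real) N M (X :: nat \<Rightarrow> real^'n) h1 h2 hbar.
     \<delta> > 0 \<and> 1 \<le> N \<and> N \<le> M \<and>
     inj_on X {1..M} \<and> X ` {1..N} \<subseteq> \<Omega> \<and> X ` {N+1..M} \<subseteq> frontier \<Omega> \<and>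
     (\<forall>j<J. chart_preimage (\<phi> j) (X ` {N+1..M}) \<noteq> {}) \<and>
     h1 = mesh_norm (X ` {1..N}) \<Omega> \<and>
     h2 = boundary_mesh_norm J \<phi> (X ` {N+1..M}) \<and>
     hbar = max h1 h2 \<and>
     real M \<le> C0 * hbar powi (- int CARD('n))
     \<longrightarrow>
     (\<delta> \<ge> 1 \<longrightarrow>
        lambda_max (colloc_matrix k \<nu> \<delta> N M X)
          \<le> C * \<delta> powi (- int CARD('n) - 2) * hbar powi (- int CARD('n))) \<and>
     (\<delta> < 1 \<longrightarrow>
        lambda_max (colloc_matrix k \<nu> \<delta> N M X)
          \<le> C * \<delta> powi (- int CARD('n) - 6) * hbar powi (- int CARD('n)))"
proof -
  obtain E where E: "E \<ge> 0" "\<And>\<delta> N (X :: nat \<Rightarrow> real^'n) p q m. \<delta> > 0 \<Longrightarrow>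
      (1 / \<delta>) ^ (CARD('n) + 2) \<le> m \<Longrightarrow> (1 / \<delta>) ^ (CARD('n) + 4) \<le> m \<Longrightarrow>
      (1 / \<delta>) ^ (CARD('n) + 6) \<le> m \<Longrightarrow> \<bar>colloc_entry k \<nu> \<delta> N X p q\<bar> \<le> E * m"
    using colloc_entry_bound[OF assms(6,5)] by metis
  \<comment> \<open>The modulus is taken because the sign of C0 is unrestricted; the summand 1 makes
    C positive even if the product is 0.\<close>
  define C where "C = real CARD('n) * E * \<bar>C0\<bar> + 1"
  have "C > 0"
    using E(1) by (simp add: C_def add_nonneg_pos)
  \<comment> \<open>For odd d the sign of hbar^-d is that of hbar, hence
    \<open>0 \<le> hbar\<close>; at hbar = 0 the power has the default value 0.\<close>
  have bound: "lambda_max (colloc_matrix k \<nu> \<delta> N M X) \<le> C * m * hbar powi (- int CARD('n))"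
    if "\<delta> > 0" "1 \<le> N" "N \<le> M" "0 \<le> hbar" "real M \<le> C0 * hbar powi (- int CARD('n))"
      and m: "(1 / \<delta>) ^ (CARD('n) + 2) \<le> m" "(1 / \<delta>) ^ (CARD('n) + 4) \<le> m" "(1 / \<delta>) ^ (CARD('n) + 6) \<le> m"
    for \<delta> m hbar :: real and N M and X :: "nat \<Rightarrow> real^'n"
  proof -
    let ?H = "hbar powi (- int CARD('n))"
    have H: "0 \<le> ?H"
      using \<open>0 \<le> hbar\<close> by simp
    have "0 \<le> (1 / \<delta>) ^ (CARD('n) + 2)"
      using \<open>\<delta> > 0\<close> by simp
    then have "0 \<le> m"
      using m(1) by linarith
    have "lambda_max (colloc_matrix k \<nu> \<delta> N M X) \<le> real (CARD('n) * M) * (E * m)"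
    proof (rule lambda_max_le_entry_bound)
      show "colloc_matrix k \<nu> \<delta> N M X \<in> carrier_mat (CARD('n) * M) (CARD('n) * M)"
        by (simp add: colloc_matrix_def)
      show "0 < CARD('n) * M"
        using that(2,3) by simp
      fix a b assume ab: "a < CARD('n) * M" "b < CARD('n) * M"
      show "colloc_matrix k \<nu> \<delta> N M X $$ (a, b) = colloc_matrix k \<nu> \<delta> N M X $$ (b, a)"
        unfolding colloc_matrix_def index_mat(1)[OF ab] index_mat(1)[OF ab(2,1)] prod.case
        by (rule colloc_entry_symmetric[OF \<open>\<delta> > 0\<close> assms(6)])
      show "\<bar>colloc_matrix k \<nu> \<delta> N M X $$ (a, b)\<bar> \<le> E * m"
        unfolding colloc_matrix_def index_mat(1)[OF ab] prod.case
        by (rule E(2)[OF \<open>\<delta> > 0\<close> m])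
    qed
    also have "\<dots> = (real CARD('n) * E * m) * real M"
      by simp
    also have "\<dots> \<le> (real CARD('n) * E * m) * (\<bar>C0\<bar> * ?H)"
    proof (rule mult_left_mono)
      have "C0 * ?H \<le> \<bar>C0\<bar> * ?H"
        using H by (intro mult_right_mono) auto
      with that(5) show "real M \<le> \<bar>C0\<bar> * ?H"
        by linarith
    qed (use E(1) \<open>0 \<le> m\<close> in simp)
    also have "\<dots> = (C - 1) * (m * ?H)"
      by (simp add: C_def)
    also have "\<dots> \<le> C * (m * ?H)"
      using H \<open>0 \<le> m\<close> by (intro mult_right_mono) auto
    finally show ?thesis
      by (simp add: mult_ac)
  qed
  have powi: "\<delta> powi (- int CARD('n) - int j) = (1 / \<delta>) ^ (CARD('n) + j)" for \<delta> :: real and j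
  proof -
    have "- int CARD('n) - int j = - int (CARD('n) + j)"
      by simp
    then show ?thesis
      by (simp only: power_int_minus power_int_of_nat power_one_over inverse_eq_divide)
  qed
  have large: "lambda_max (colloc_matrix k \<nu> \<delta> N M X) \<le> C * \<delta> powi (- int CARD('n) - 2) * hbar powi (- int CARD('n))"
    if "\<delta> \<ge> 1" "1 \<le> N" "N \<le> M" "0 \<le> hbar" "real M \<le> C0 * hbar powi (- int CARD('n))"
    for \<delta> hbar :: real and N M and X :: "nat \<Rightarrow> real^'n"
  proof -
    \<comment> \<open>Here 1 / \<delta> \<le> 1, so the smallest exponent dominates; for \<delta> <
      1 it is the largest.\<close>
    have mono: "(1 / \<delta>) ^ (CARD('n) + i) \<le> (1 / \<delta>) ^ (CARD('n) + 2)" if "2 \<le> i" for i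
      using that \<open>\<delta> \<ge> 1\<close> by (intro power_decreasing) auto
    show ?thesis
      unfolding powi[of \<delta> 2, unfolded of_nat_numeral]
      by (intro bound that mono) (use that(1) in linarith)+
  qed
  have small: "lambda_max (colloc_matrix k \<nu> \<delta> N M X) \<le> C * \<delta> powi (- int CARD('n) - 6) * hbar powi (- int CARD('n))"
    if "\<delta> > 0" "\<delta> < 1" "1 \<le> N" "N \<le> M" "0 \<le> hbar" "real M \<le> C0 * hbar powi (- int CARD('n))"
    for \<delta> hbar :: real and N M and X :: "nat \<Rightarrow> real^'n"
  proof -
    have mono: "(1 / \<delta>) ^ (CARD('n) + i) \<le> (1 / \<delta>) ^ (CARD('n) + 6)" if "i \<le> 6" for i
      using that \<open>\<delta> > 0\<close> \<open>\<delta> < 1\<close> by (intro power_increasing) auto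
    show ?thesis
      unfolding powi[of \<delta> 6, unfolded of_nat_numeral]
      by (intro bound that mono) (use that(1) in linarith)+
  qed
  \<comment> \<open>The interior mesh norm alone fixes the sign of the maximum, so h2 stays
    arbitrary.\<close>
  have hbar: "0 \<le> max (mesh_norm (X ` {1..N}) \<Omega>) h2" if "1 \<le> N" for X :: "nat \<Rightarrow> real^'n" and N :: nat and h2
  proof -
    have "0 \<le> mesh_norm (X ` {1..N}) \<Omega>"
      by (rule mesh_norm_nonneg) (use assms(3) that in \<open>auto simp: bounded_smooth_domain_def\<close>)
    then show ?thesis
      by (rule max.coboundedI1)
  qed
  show ?thesis
    by (intro exI[of _ C] conjI allI impI \<open>C > 0\<close>; elim conjE; hypsubst; rule large small; (assumption | rule hbar))
qed

end
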